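(* Let $r$ be a positive integer, let $t$ be a positive integer such that $t^4\le 2^r$, and let $a$ be any nonzero element of the finite field $\mathbb{F}_{2^r}$. Then the function $\mathbb{F}_{2^r}\to\mathbb{F}_{2^r}$, $c\mapsto ac^t$, is planar on $\mathbb{F}_{2^r}$ if and only if $t$ is a power of $2$.
   Context: Let $q$ be a power of $2$. A function $f\colon\mathbb{F}_q\to\mathbb{F}_q$ is called planar (in Zhou's sense for characteristic $2$) if, for every $b\in\mathbb{F}_q^*$, the function $c\mapsto f(c+b)+f(c)+bc$ is a bijection on $\mathbb{F}_q$. Powers of $2$ include $1=2^0$. *)

theory Defs
  imports "HOL-Library.Cardinality" "HOL-Computational_Algebra.Computational_Algebra"
begin

text \<open>
  Planarity in the sense of Zhou. The notion is intended for finite fields of characteristic two;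
  the definition itself does not impose the characteristic.
\<close>

definition planar :: "('a::{field,finite} \<Rightarrow> 'a) \<Rightarrow> bool" where
  "planar f \<longleftrightarrow> (\<forall>b. b \<noteq> 0 \<longrightarrow> bij (\<lambda>c. f (c + b) + f c + b * c))"

end

theory Submission
  imports
    "HOL-Algebra.Algebraic_Closure_Type"
    "HOL-Computational_Algebra.Fundamental_Theorem_Algebra"
    Defs
begin

text \<open>
  If \<open>a c\<^sup>t\<close> is planar, comparing \<open>c = 0\<close> with \<open>c = e\<close> for \<open>b = x e\<close> shows that
  \<open>a f(x) e\<^bsup>t-2\<^esup>\<close> is never \<open>1\<close>, where \<open>x f(x) = (x + 1)\<^sup>t + x\<^sup>t + 1\<close>. Thus \<open>a f(x)\<close> is never
  a nonzero \<open>d\<close>-th power for \<open>x\<close> nonzero, with \<open>d = gcd (t - 2) (q - 1)\<close>. Write \<open>t = 2\<^sup>k s\<close> with \<open>s\<close> odd.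
  If \<open>s > 1\<close>, the root \<open>1\<close> of \<open>f\<close> has multiplicity \<open>2\<^sup>k\<close>, which is prime to \<open>d\<close>, so
  Weil's bound \<open>(deg f - 1) sqrt q\<close> holds for the sums of \<open>\<chi>(f(x))\<close> over the nontrivial characters \<open>\<chi>\<close>
  of order dividing \<open>d\<close>; since \<open>d, deg f \<le> t - 2\<close> and \<open>t\<^sup>4 \<le> q\<close>, it produces a forbidden \<open>x\<close>.

  Weil's bound is proved in the elementary way: the \<open>L\<close>-function of \<open>\<chi>\<close> is a polynomial of degree
  less than \<open>deg f\<close> whose inverse roots have the character sums over the extensions of the field
  as (negated) power sums, and Stepanov's method bounds these sums up to a constant.
\<close>

section \<open>Stepanov's method\<close>

text \<open>Nothing is used about the roots of \<open>f\<close> other than 1, which may well repeat,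
  so every argument runs on one rational root \<theta> whose multiplicity \<open>e\<close> is prime
  to \<open>d\<close>. It serves twice: it separates valuations in Stepanov's auxiliary polynomial,
  and it makes \<open>\<chi> (u ^ e)\<close> nontrivial, which turns the L-function into a
  polynomial. Stepanov's method bounds only from above how often a power of \<open>f\<close> takes a
  given value; the other direction follows because these classes fill the whole field up to the
  zeros of \<open>f\<close>. Its constant may be large as long as it is the same for all extensions:
  bounds of order q^(k/2) for every k force each inverse root below sqrt q, and the constant is gone
  on the return to k = 1. All extensions live in one algebraic closure, that of degree k being the
  set of fixed points of x -> x^(q^k). The exponent 4 in the theorem comes from the final count,
  where at most (t - 3)^2 sqrt q has to stay below q with room for lower-order terms; t^2 <= sqrt q
  gives this.\<close>

lemma homogeneous_system_solution:
  fixes a :: "'i \<Rightarrow> 'j \<Rightarrow> 'b::field"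
  assumes "finite K" "finite I" "card K < card I"
  shows "\<exists>c. (\<exists>i\<in>I. c i \<noteq> 0) \<and> (\<forall>k\<in>K. (\<Sum>i\<in>I. c i * a i k) = 0)"
  using assms
proof (induction K arbitrary: I a rule: finite_induct)
  case empty
  then have "I \<noteq> {}" by auto
  then show ?case by (intro exI[of _ "\<lambda>_. 1"]) auto
next
  case (insert k K)
  show ?case
  proof (cases "\<forall>i\<in>I. a i k = 0")
    case True
    from insert have "card K < card I" by simp
    from insert.IH[OF insert.prems(1) this, of a] obtain c
      where "\<exists>i\<in>I. c i \<noteq> 0" "\<forall>k\<in>K. (\<Sum>i\<in>I. c i * a i k) = 0" by blast
    with True show ?thesis by (intro exI[of _ c]) auto
  next
    case False
    then obtain i0 where i0: "i0 \<in> I" "a i0 k \<noteq> 0" by auto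
    let ?J = "I - {i0}"
    have c: "card K < card ?J" using insert i0 by simp
    \<comment> \<open>Gaussian elimination: equation \<open>k\<close> is solved for the unknown
      \<open>i0\<close> and substituted into the others, which removes one equation and one unknown;
      \<open>c'\<close> restores the value at \<open>i0\<close>.\<close>
    obtain c where c1: "\<exists>i\<in>?J. c i \<noteq> 0" and
      c2: "\<And>j. j \<in> K \<Longrightarrow> (\<Sum>i\<in>?J. c i * (a i j - a i k / a i0 k * a i0 j)) = 0"
      using insert.IH[of ?J "\<lambda>i j. a i j - a i k / a i0 k * a i0 j"] c insert.prems(1) by auto
    define c' where "c' i = (if i = i0 then - (\<Sum>i\<in>?J. c i * a i k) / a i0 k else c i)" for i
    have s: "(\<Sum>i\<in>I. c' i * a i j) = c' i0 * a i0 j + (\<Sum>i\<in>?J. c i * a i j)" for j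
      using insert.prems(1) i0(1) by (subst sum.remove[of _ i0]) (auto simp: c'_def intro!: sum.cong)
    have "(\<Sum>i\<in>I. c' i * a i j) = 0" if "j \<in> insert k K" for j
    proof (cases "j = k")
      case True
      then show ?thesis unfolding s using i0 by (simp add: c'_def)
    next
      case False
      with that have "j \<in> K" by auto
      from c2[OF this] have "(\<Sum>i\<in>?J. c i * a i j) = (\<Sum>i\<in>?J. c i * a i k * (a i0 j / a i0 k))"
        by (simp add: right_diff_distrib sum_subtractf mult.assoc)
      also have "\<dots> = (\<Sum>i\<in>?J. c i * a i k) * (a i0 j / a i0 k)"
        by (simp add: sum_distrib_right sum_divide_distrib)
      finally show ?thesis unfolding s by (simp add: c'_def)
    qed
    moreover have "\<exists>i\<in>I. c' i \<noteq> 0" using c1 by (auto simp: c'_def)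
    ultimately show ?thesis by blast
  qed
qed

text \<open>The i-th derivative divided by the factorial of i, formed without division: in
  characteristic p the ordinary derivatives vanish from order p on and cannot detect high
  multiplicity. For \<open>k < i\<close> the binomial is 0, so the truncated exponent is
  harmless.\<close>

definition hasse_deriv :: "nat \<Rightarrow> 'b::comm_ring_1 poly \<Rightarrow> 'b poly" where
  "hasse_deriv i p = (\<Sum>k\<le>degree p. monom (of_nat (k choose i) * coeff p k) (k - i))"

lemma hasse_deriv_eq_0: "degree p < i \<Longrightarrow> hasse_deriv i p = 0"
  unfolding hasse_deriv_def by (intro sum.neutral) (auto simp: binomial_eq_0)

lemma degree_hasse_deriv: "degree (hasse_deriv i p) \<le> degree p - i"
  unfolding hasse_deriv_def
  by (intro degree_sum_le) (auto intro: order.trans[OF degree_monom_le] diff_le_mono)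

lemma coeff_linear_poly_power':
  fixes x c :: "'b::comm_ring_1"
  shows "coeff ([:x, c:] ^ k) i = of_nat (k choose i) * c ^ i * x ^ (k - i)"
proof (cases "i \<le> k")
  case False
  have "degree ([:x, c:] ^ k) \<le> degree [:x,c:] * k" by (rule degree_power_le)
  also have "\<dots> \<le> k" by simp
  finally show ?thesis using False by (simp add: coeff_eq_0 binomial_eq_0)
qed (simp add: coeff_linear_poly_power)

text \<open>Taylor's formula at \<open>x\<close> in the increment \<open>c * Y\<close>, by the
  binomial theorem on each monomial.\<close>

lemma coeff_pcompose_linear_hasse_deriv:
  fixes x c :: "'b::comm_ring_1"
  shows "coeff (pcompose p [:x, c:]) i = poly (hasse_deriv i p) x * c ^ i"
proof -
  have "pcompose p [:x, c:] = (\<Sum>k\<le>degree p. smult (coeff p k) ([:x, c:] ^ k))"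
    by (simp add: pcompose_altdef poly_altdef coeff_map_poly degree_map_poly)
  then show ?thesis
    by (simp add: coeff_sum coeff_linear_poly_power' hasse_deriv_def poly_sum poly_monom
        sum_distrib_left sum_distrib_right mult_ac)
qed

section \<open>Taylor expansion with an increment proportional to f\<close>

text \<open>
  Polynomials in \<open>Y\<close> over polynomials in \<open>X\<close>: \<open>scaled_shift f p\<close> is \<open>p(X + f(X) Y)\<close> and
  \<open>scaled_shift_quot f\<close> is \<open>f(X + f(X) Y) / f(X)\<close>. Scaling the increment by \<open>f(X)\<close> makes the quotient
  polynomial and keeps the degree of the coefficient of \<open>Y\<^sup>i\<close> linear in \<open>i\<close> however high a power of it is taken.
\<close>

definition scaled_shift :: "'b::comm_ring_1 poly \<Rightarrow> 'b poly \<Rightarrow> 'b poly poly" where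
  "scaled_shift f p = (\<Sum>i\<le>degree p. monom (hasse_deriv i p * f ^ i) i)"

definition scaled_shift_quot :: "'b::comm_ring_1 poly \<Rightarrow> 'b poly poly" where
  "scaled_shift_quot f = 1 + (\<Sum>i\<in>{1..degree f}. monom (hasse_deriv i f * f ^ (i - 1)) i)"

lemma coeff_scaled_shift: "coeff (scaled_shift f p) i = hasse_deriv i p * f ^ i"
  by (cases "i \<le> degree p") (auto simp: scaled_shift_def coeff_sum hasse_deriv_eq_0 if_distrib cong: if_cong)

lemma coeff_scaled_shift_quot:
  "coeff (scaled_shift_quot f) i = (if i = 0 then 1 else hasse_deriv i f * f ^ (i - 1))"
  by (cases "i \<le> degree f") (auto simp: scaled_shift_quot_def coeff_sum hasse_deriv_eq_0 if_distrib coeff_1 cong: if_cong)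

abbreviation eval_coeffs :: "'b::comm_ring_1 \<Rightarrow> 'b poly poly \<Rightarrow> 'b poly" where
  "eval_coeffs x \<equiv> map_poly (\<lambda>c. poly c x)"

lemma eval_coeffs_mult: "eval_coeffs x (A * B) = eval_coeffs x A * eval_coeffs x B"
  by (rule poly_eqI) (simp add: coeff_map_poly coeff_mult poly_sum)

lemma eval_coeffs_power: "eval_coeffs x (A ^ n) = eval_coeffs x A ^ n"
  by (induction n) (simp_all add: eval_coeffs_mult map_poly_1')

lemma eval_coeffs_scaled_shift: "eval_coeffs x (scaled_shift f p) = pcompose p [:x, poly f x:]"
  by (rule poly_eqI)
    (simp add: coeff_map_poly coeff_scaled_shift coeff_pcompose_linear_hasse_deriv)

lemma eval_coeffs_scaled_shift_quot:
  "[:poly f x:] * eval_coeffs x (scaled_shift_quot f) = pcompose f [:x, poly f x:]"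
proof (rule poly_eqI)
  fix i
  show "coeff ([:poly f x:] * eval_coeffs x (scaled_shift_quot f)) i = coeff (pcompose f [:x, poly f x:]) i"
  proof (cases i)
    case 0
    have "coeff (pcompose f [:x, poly f x:]) 0 = poly f x"
      by (metis poly_0_coeff_0 poly_pcompose mult_zero_left add.right_neutral poly_pCons)
    then show ?thesis using 0 by (simp add: coeff_map_poly coeff_scaled_shift_quot del: coeff_pcompose_0)
  next
    case (Suc k)
    then show ?thesis
      by (simp add: coeff_map_poly coeff_scaled_shift_quot coeff_pcompose_linear_hasse_deriv mult_ac)
  qed
qed

text \<open>Each power of Y is allowed \<open>m\<close> more in degree. The offsets \<open>c\<close>
  add under multiplication, so offset 0 survives arbitrary powers: this keeps the exponents
  \<open>E * l\<close> out of the number of linear conditions.\<close>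

definition graded :: "nat \<Rightarrow> nat \<Rightarrow> 'b::comm_ring_1 poly poly \<Rightarrow> bool" where
  "graded m c W \<longleftrightarrow> (\<forall>i. degree (coeff W i) \<le> c + i * m)"

lemma graded_mult:
  assumes "graded m a V" "graded m b W"
  shows "graded m (a + b) (V * W)"
  unfolding graded_def coeff_mult
proof (intro allI degree_sum_le)
  fix n i :: nat assume "i \<in> {..n}"
  then have i: "n = i + (n - i)" by auto
  have "degree (coeff V i * coeff W (n - i)) \<le> degree (coeff V i) + degree (coeff W (n - i))"
    by (rule degree_mult_le)
  also have "\<dots> \<le> (a + i * m) + (b + (n - i) * m)"
    using assms unfolding graded_def by (intro add_mono) auto
  also have "\<dots> = a + b + n * m" by (subst (2) i) (simp add: algebra_simps)
  finally show "degree (coeff V i * coeff W (n - i)) \<le> a + b + n * m" .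
qed auto

lemma graded_power: "graded m 0 V \<Longrightarrow> graded m 0 (V ^ n)"
proof (induction n)
  case 0 then show ?case by (auto simp: graded_def)
next
  case (Suc n) then show ?case using graded_mult[of m 0 V 0 "V ^ n"] by simp
qed

lemma graded_scaled_shift: "graded (degree f) (degree p) (scaled_shift f p)"
  unfolding graded_def coeff_scaled_shift
proof
  fix i
  have "degree (hasse_deriv i p * f ^ i) \<le> degree (hasse_deriv i p) + degree (f ^ i)" by (rule degree_mult_le)
  also have "\<dots> \<le> degree p + i * degree f"
    by (intro add_mono order.trans[OF degree_hasse_deriv]) (auto intro: order.trans[OF degree_power_le])
  finally show "degree (hasse_deriv i p * f ^ i) \<le> degree p + i * degree f" .
qed

lemma graded_scaled_shift_quot: "graded (degree f) 0 (scaled_shift_quot f)"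
  unfolding graded_def
proof
  fix i
  show "degree (coeff (scaled_shift_quot f) i) \<le> 0 + i * degree f"
  proof (cases i)
    case (Suc k)
    have "degree (hasse_deriv i f * f ^ k) \<le> degree (hasse_deriv i f) + degree (f ^ k)" by (rule degree_mult_le)
    also have "\<dots> \<le> degree f + k * degree f"
      by (intro add_mono order.trans[OF degree_hasse_deriv]) (auto intro: order.trans[OF degree_power_le])
    finally show ?thesis using Suc by (simp add: coeff_scaled_shift_quot)
  qed (simp add: coeff_scaled_shift_quot)
qed

text \<open>Among the terms with nonzero coefficient one has the least valuation; after dividing by
  that power only this term survives at \<theta>. It ensures that the auxiliary polynomial is not
  0.\<close>

lemma sum_distinct_valuations_nonzero:
  fixes \<theta> :: "'b::field"
  assumes "finite I" "inj_on v I" "\<And>i. i \<in> I \<Longrightarrow> poly (g i) \<theta> \<noteq> 0" "\<exists>i\<in>I. c i \<noteq> 0"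
  shows "(\<Sum>i\<in>I. smult (c i) ([:-\<theta>, 1:] ^ v i * g i)) \<noteq> 0"
proof -
  let ?I = "{i\<in>I. c i \<noteq> 0}"
  have fin: "finite ?I" "?I \<noteq> {}" using assms by auto
  obtain i0 where i0: "i0 \<in> ?I" "\<And>i. i \<in> ?I \<Longrightarrow> v i0 \<le> v i"
    using ex_is_arg_min_if_finite[OF fin, of v] by (auto simp: is_arg_min_linorder)
  let ?h = "\<Sum>i\<in>?I. smult (c i) ([:-\<theta>, 1:] ^ (v i - v i0) * g i)"
  have "(\<Sum>i\<in>I. smult (c i) ([:-\<theta>, 1:] ^ v i * g i)) = (\<Sum>i\<in>?I. smult (c i) ([:-\<theta>, 1:] ^ v i * g i))"
    using assms(1) by (intro sum.mono_neutral_right) auto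
  also have "\<dots> = (\<Sum>i\<in>?I. [:-\<theta>, 1:] ^ v i0 * smult (c i) ([:-\<theta>, 1:] ^ (v i - v i0) * g i))"
  proof (intro sum.cong refl)
    fix i assume "i \<in> ?I"
    then have "[:-\<theta>, 1:] ^ v i = [:-\<theta>, 1:] ^ v i0 * [:-\<theta>, 1:] ^ (v i - v i0)"
      using i0(2) by (simp only: power_add[symmetric] le_add_diff_inverse)
    then show "smult (c i) ([:-\<theta>, 1:] ^ v i * g i) = [:-\<theta>, 1:] ^ v i0 * smult (c i) ([:-\<theta>, 1:] ^ (v i - v i0) * g i)"
      by (simp add: mult.assoc)
  qed
  also have "\<dots> = [:-\<theta>, 1:] ^ v i0 * ?h" by (simp add: sum_distrib_left)
  finally have eq: "(\<Sum>i\<in>I. smult (c i) ([:-\<theta>, 1:] ^ v i * g i)) = [:-\<theta>, 1:] ^ v i0 * ?h" .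
  have "poly ?h \<theta> = (\<Sum>i\<in>?I. if i = i0 then c i0 * poly (g i0) \<theta> else 0)"
    unfolding poly_sum
  proof (intro sum.cong refl)
    fix i assume i: "i \<in> ?I"
    have "v i - v i0 > 0" if "i \<noteq> i0"
    proof -
      have "v i \<noteq> v i0" using inj_onD[OF assms(2), of i i0] i i0(1) that by auto
      with i0(2)[OF i] show ?thesis by simp
    qed
    then show "poly (smult (c i) ([:-\<theta>, 1:] ^ (v i - v i0) * g i)) \<theta> =
        (if i = i0 then c i0 * poly (g i0) \<theta> else 0)"
      by (auto simp: poly_power power_0_left)
  qed
  also have "\<dots> = c i0 * poly (g i0) \<theta>" using fin i0(1) by simp
  also have "\<dots> \<noteq> 0" using i0(1) assms(3) by auto
  finally have "?h \<noteq> 0" by auto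
  then show ?thesis unfolding eq by simp
qed

text \<open>The affine substitution is undone by Y -> (X - x) / y. In the application y is
  \<open>poly f x\<close>, so zeros of \<open>f\<close> must be excluded from the points
  counted.\<close>

lemma linear_power_dvd_of_coeff_pcompose:
  fixes x y :: "'b::field"
  assumes "y \<noteq> 0" "\<And>i. i < M \<Longrightarrow> coeff (pcompose p [:x, y:]) i = 0"
  shows "[:-x, 1:] ^ M dvd p"
proof -
  have "monom 1 M dvd pcompose p [:x, y:]"
    using assms(2) by (simp add: monom_1_dvd_iff')
  then obtain r where r: "pcompose p [:x, y:] = monom 1 M * r" by (elim dvdE)
  let ?L = "[:-x / y, 1 / y:]"
  have "p = pcompose (pcompose p [:x, y:]) ?L"
    using assms(1) by (simp add: pcompose_pCons flip: pcompose_assoc)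
  also have "\<dots> = pcompose (monom 1 M) ?L * pcompose r ?L" by (simp add: r pcompose_mult)
  also have "pcompose (monom 1 M) ?L = ?L ^ M"
    by (simp add: pcompose_altdef map_poly_monom poly_monom one_pCons[symmetric])
  also have "?L ^ M = smult ((1 / y) ^ M) ([:-x, 1:] ^ M)" by (simp flip: smult_power)
  finally have *: "p = smult ((1 / y) ^ M) ([:-x, 1:] ^ M) * pcompose r ?L" .
  have "[:-x, 1:] ^ M dvd smult ((1 / y) ^ M) ([:-x, 1:] ^ M) * pcompose r ?L"
    by (intro dvd_mult2 dvd_smult dvd_refl)
  then show ?thesis using * by simp
qed

lemma card_multiple_roots_le:
  fixes p :: "'b::field poly"
  assumes "p \<noteq> 0" "finite S" "\<And>x. x \<in> S \<Longrightarrow> [:-x, 1:] ^ M dvd p"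
  shows "M * card S \<le> degree p"
proof -
  have "M * card S = (\<Sum>x\<in>S. M)" by simp
  also have "\<dots> \<le> (\<Sum>x\<in>S. count (proots p) x)"
    using assms by (intro sum_mono) (simp add: order_divides)
  also have "\<dots> \<le> (\<Sum>x\<in>S \<union> set_mset (proots p). count (proots p) x)"
    by (intro sum_mono2 finite_UnI finite_set_mset assms(2)) auto
  also have "\<dots> = (\<Sum>x\<in>set_mset (proots p). count (proots p) x)"
    by (intro sum.mono_neutral_right finite_UnI finite_set_mset assms(2)) (auto simp: not_in_iff simp del: set_count_proots)
  also have "\<dots> = size (proots p)" by (simp add: size_multiset_overloaded_eq)
  also have "\<dots> \<le> degree p" by (rule size_proots_le)
  finally show ?thesis .
qed


text \<open>The auxiliary polynomial is a combination of the products
  \<open>(X - \<theta>)\<^sup>k f\<^sup>E\<^sup>l (X - \<theta>)\<^sup>Q\<^sup>j\<close>; their valuations at \<open>\<theta>\<close> differ because \<open>e\<close> is coprime to \<open>d\<close>.\<close>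

lemma valuation_injective:
  fixes Q d E e A :: nat
  assumes dE: "d * E = Q - 1" and Q: "Q > 0" and d: "d > 0" and cop: "coprime e d" and A: "A + e \<le> E" and e: "e > 0"
    and l: "l < d" "l' < d" and k: "k \<le> A" "k' \<le> A"
    and eq: "e * E * l + Q * j + k = e * E * l' + Q * j' + k'"
  shows "l = l' \<and> j = j' \<and> k = k'"
proof -
  \<comment> \<open>Multiplying the equation by \<open>d\<close> and replacing \<open>d * E\<close>
    by \<open>Q - 1\<close> turns it into \<open>Q * z = w\<close>. Since
    \<open>A + e \<le> E\<close> gives |w| < Q, both vanish, and coprimality of \<open>e\<close> and
    \<open>d\<close> then yields \<open>l = l'\<close>.\<close>
  define z where "z = int e * (int l - int l') + int d * (int j - int j')"
  define w where "w = int e * (int l - int l') + int d * (int k' - int k)"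
  have dE': "int d * int E = int Q - 1"
    using dE Q by (metis Suc_leI int_ops(7) of_nat_1 of_nat_diff One_nat_def)
  have "int d * (int e * int E * int l + int Q * int j + int k) =
      int d * (int e * int E * int l' + int Q * int j' + int k')"
    using arg_cong[OF eq, of int] by simp
  then have "(int d * int E) * (int e * (int l - int l')) + int d * int Q * (int j - int j') = int d * (int k' - int k)"
    by (simp add: algebra_simps)
  then have zw: "int Q * z = w" unfolding dE' z_def w_def by (simp add: algebra_simps)
  have "\<bar>w\<bar> \<le> int e * \<bar>int l - int l'\<bar> + int d * \<bar>int k' - int k\<bar>"
    unfolding w_def by (intro order.trans[OF abs_triangle_ineq]) (simp add: abs_mult)
  also have "\<dots> \<le> int e * (int d - 1) + int d * int A"
    using l k by (intro add_mono mult_left_mono) auto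
  also have "\<dots> = int d * (int A + int e) - int e" by (simp add: algebra_simps)
  also have "\<dots> \<le> int d * int E - int e" using A by (intro diff_right_mono mult_left_mono) auto
  also have "\<dots> < int Q" using dE' e by simp
  finally have "\<bar>int Q * z\<bar> < int Q" using zw by simp
  then have "int Q * \<bar>z\<bar> < int Q * 1" by (simp add: abs_mult)
  then have z0: "z = 0" using Q by (simp add: mult_less_cancel_left)
  then have "int e * (int l - int l') = int d * (int j' - int j)"
    unfolding z_def by (simp add: algebra_simps)
  then have "int d dvd int e * (int l - int l')" by simp
  moreover have "coprime (int d) (int e)" using cop by (simp add: coprime_commute)
  ultimately have dv: "int d dvd int l - int l'"
    by (simp add: coprime_dvd_mult_right_iff)
  have ll: "l = l'"
  proof (rule ccontr)
    assume "l \<noteq> l'"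
    with dv have "\<bar>int d\<bar> \<le> \<bar>int l - int l'\<bar>" by (intro dvd_imp_le_int) auto
    with l show False by auto
  qed
  then have "j = j'" using z0 d unfolding z_def by simp
  with ll eq show ?thesis by simp
qed

text \<open>There are \<open>d * J * (A + 1)\<close> free coefficients. At the points counted, the
  i-th Taylor coefficient of the combination is the value of a polynomial of degree below
  \<open>A + J + i * m\<close>; making that polynomial 0 for all \<open>i < M\<close> costs fewer
  conditions by \<open>count\<close>. Each point is then a root of multiplicity at least
  \<open>M\<close>, and comparison with the degree finishes.\<close>

lemma stepanov_auxiliary:
  fixes f g :: "'b::field poly" and \<theta> \<omega> :: 'b
  assumes char: "prime CHAR('b)" "Q = CHAR('b) ^ s"
    and f: "f = [:-\<theta>, 1:] ^ e * g" "poly g \<theta> \<noteq> 0" "\<theta> ^ Q = \<theta>"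
    and d: "d * E = Q - 1" "d > 0" "coprime e d" "e > 0"
    and A: "A + e \<le> E" and M: "M \<le> Q"
    and count: "(\<Sum>i<M. A + J + i * degree f) < d * J * (A + 1)"
  shows "M * card {x. x ^ Q = x \<and> poly f x \<noteq> 0 \<and> poly f x ^ E = \<omega>} \<le> Q * (J + degree f)"
proof -
  define m where "m = degree f"
  define S where "S = {x. x ^ Q = x \<and> poly f x \<noteq> 0 \<and> poly f x ^ E = \<omega>}"
  have Q: "Q > 0" using char prime_gt_0_nat by auto
  have "d * E > 0" using A d(2,4) by simp
  then have Q1: "Q > 1" unfolding d(1) by simp
  have g0: "g \<noteq> 0" using f(2) by auto
  have f0: "f \<noteq> 0" using g0 unfolding f(1) by simp
  have m1: "m \<ge> 1" using g0 d(4) unfolding m_def f(1) by (simp add: degree_mult_eq degree_linear_power)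
  have J: "J > 0" using count by (cases J) auto
  define I where "I = {..<d} \<times> {..<J} \<times> {..A}"
  define K where "K = Sigma {..<M} (\<lambda>i. {..<A + J + i * m})"
  define v where "v = (\<lambda>(l,j,k). e * E * l + Q * j + k)"
  define G where "G = (\<lambda>(l::nat,j::nat,k::nat). g ^ (E * l))"
  define B where "B = (\<lambda>(l,j,k). [:-\<theta>, 1:] ^ k * f ^ (E * l) * [:-\<theta>, 1:] ^ (Q * j))"
  \<comment> \<open>The Taylor coefficient of \<open>B\<close> simplified by the equations valid on
    \<open>S\<close>: \<open>f ^ (E * l)\<close> leaves the constant \<open>\<omega> ^ l\<close> and
    a power of \<open>scaled_shift_quot f\<close>, while the exponent \<open>Q * j\<close> shrinks
    to \<open>j\<close>.\<close>
  define Z where "Z = (\<lambda>(l,j,k) i. smult (\<omega> ^ l) ([:-\<theta>, 1:] ^ j *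
     coeff (scaled_shift f ([:-\<theta>, 1:] ^ k) * scaled_shift_quot f ^ (E * l)) i))"
  have finI: "finite I" "finite K" unfolding I_def K_def by auto
  have cI: "card I = d * J * (A + 1)" unfolding I_def by (simp add: algebra_simps)
  have cK: "card K = (\<Sum>i<M. A + J + i * m)" unfolding K_def by simp
  have degZ: "coeff (Z u i) s = 0" if "u \<in> I" "s \<ge> A + J + i * m" for u i s
  proof -
    obtain l j k where u: "u = (l,j,k)" by (cases u)
    have lt: "l < d" "j < J" "k \<le> A" using that(1) unfolding u I_def by auto
    have "graded m (k + 0) (scaled_shift f ([:-\<theta>, 1:] ^ k) * scaled_shift_quot f ^ (E * l))"
      unfolding m_def
      by (intro graded_mult graded_power graded_scaled_shift_quot)
        (use graded_scaled_shift[of f "[:-\<theta>, 1:] ^ k"] in \<open>simp add: degree_linear_power\<close>)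
    then have *: "degree (coeff (scaled_shift f ([:-\<theta>, 1:] ^ k) * scaled_shift_quot f ^ (E * l)) i) \<le> k + i * m"
      unfolding graded_def by simp
    have "degree (Z u i) \<le> degree ([:-\<theta>, 1:] ^ j *
        coeff (scaled_shift f ([:-\<theta>, 1:] ^ k) * scaled_shift_quot f ^ (E * l)) i)"
      unfolding Z_def u by (simp add: degree_smult_le)
    also have "\<dots> \<le> j + (k + i * m)"
      using * by (intro order.trans[OF degree_mult_le]) (simp add: degree_linear_power)
    also have "\<dots> < s" using lt that(2) by simp
    finally show ?thesis by (simp add: coeff_eq_0)
  qed
  have local: "coeff (pcompose (B u) [:x, poly f x:]) i = poly (Z u i) x"
    if u: "u \<in> I" and x: "x \<in> S" and i: "i < M" for u x i
  proof -
    obtain l j k where ul: "u = (l,j,k)" by (cases u)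
    let ?L = "[:x, poly f x:]"
    have xS: "x ^ Q = x" "poly f x ^ E = \<omega>" using x unfolding S_def by auto
    have charp: "prime CHAR('b poly)" "Q = CHAR('b poly) ^ s" using char by simp_all
    have "pcompose [:-\<theta>, 1:] ?L = [:x - \<theta>:] + monom (poly f x) 1"
      by (simp add: pcompose_pCons monom_altdef)
    then have "pcompose [:-\<theta>, 1:] ?L ^ Q = ([:x - \<theta>:] + monom (poly f x) 1) ^ Q" by (rule arg_cong)
    also have "\<dots> = [:x - \<theta>:] ^ Q + monom (poly f x) 1 ^ Q"
      by (rule freshmans_dream'[OF charp])
    also have "[:x - \<theta>:] ^ Q = [:(x - \<theta>) ^ Q:]" by (simp add: poly_const_pow)
    also have "(x - \<theta>) ^ Q = x - \<theta>"
    proof -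
      have "x ^ Q = (x - \<theta>) ^ Q + \<theta> ^ Q"
        using freshmans_dream'[OF char, of "x - \<theta>" \<theta>] by simp
      then show ?thesis using xS f(3) by (simp add: algebra_simps)
    qed
    finally have LQ: "pcompose [:-\<theta>, 1:] ?L ^ Q = [:x - \<theta>:] + monom (poly f x ^ Q) Q"
      by (simp add: monom_power)
    \<comment> \<open>By Frobenius, the Q-th power of X - \<theta> expands to the constant x -
      \<theta> plus a multiple of Y^Q; the orders below \<open>M \<le> Q\<close> see only the
      constant.\<close>
    have "monom 1 Q dvd (pcompose [:-\<theta>, 1:] ?L ^ Q) ^ j - [:x - \<theta>:] ^ j"
    proof -
      have "monom 1 Q dvd monom (poly f x ^ Q) Q"
        by (simp add: monom_1_dvd_iff')
      also have "monom (poly f x ^ Q) Q = pcompose [:-\<theta>, 1:] ?L ^ Q - [:x - \<theta>:]" using LQ by simp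
      also have "\<dots> dvd (pcompose [:-\<theta>, 1:] ?L ^ Q) ^ j - [:x - \<theta>:] ^ j"
        by (rule dvdI[OF power_diff_sumr2])
      finally show ?thesis .
    qed
    then obtain r where "(pcompose [:-\<theta>, 1:] ?L ^ Q) ^ j - [:x - \<theta>:] ^ j = monom 1 Q * r"
      by (elim dvdE)
    then have r: "(pcompose [:-\<theta>, 1:] ?L ^ Q) ^ j = [:x - \<theta>:] ^ j + monom 1 Q * r"
      by (simp only: diff_eq_eq add.commute)
    let ?V = "pcompose ([:-\<theta>, 1:] ^ k * f ^ (E * l)) ?L"
    have pw: "pcompose (p ^ n) ?L = pcompose p ?L ^ n" for p :: "'b poly" and n
      by (induction n) (simp_all add: pcompose_mult pcompose_1)
    have "pcompose (B u) ?L = ?V * (pcompose [:-\<theta>, 1:] ?L ^ Q) ^ j"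
      unfolding B_def ul by (simp add: pcompose_mult pw power_mult)
    also have "\<dots> = smult ((x - \<theta>) ^ j) ?V + monom 1 Q * (r * ?V)"
      unfolding r by (simp add: poly_const_pow algebra_simps)
    finally have "coeff (pcompose (B u) ?L) i = (x - \<theta>) ^ j * coeff ?V i"
      using i M by (simp add: coeff_monom_mult)
    also have "?V = pcompose ([:-\<theta>, 1:] ^ k) ?L * ([:poly f x:] * eval_coeffs x (scaled_shift_quot f)) ^ (E * l)"
      unfolding eval_coeffs_scaled_shift_quot by (simp add: pcompose_mult pw)
    also have "\<dots> = smult (\<omega> ^ l) (eval_coeffs x (scaled_shift f ([:-\<theta>, 1:] ^ k) * scaled_shift_quot f ^ (E * l)))"
      unfolding eval_coeffs_mult eval_coeffs_scaled_shift eval_coeffs_power power_mult_distrib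
      using xS(2) by (simp add: poly_const_pow power_mult)
    finally show ?thesis
      unfolding Z_def ul by (simp add: coeff_map_poly poly_power mult_ac)
  qed
  obtain c where c1: "\<exists>u\<in>I. c u \<noteq> 0"
    and c2: "\<And>i s. (i, s) \<in> K \<Longrightarrow> (\<Sum>u\<in>I. c u * coeff (Z u i) s) = 0"
    using homogeneous_system_solution[OF finI(2,1), of "\<lambda>u (i,s). coeff (Z u i) s"] count
    unfolding cI cK m_def by fastforce
  define \<Psi> where "\<Psi> = (\<Sum>u\<in>I. smult (c u) (B u))"
  have Bv: "B u = [:-\<theta>, 1:] ^ v u * G u" for u
    unfolding B_def v_def G_def f(1)
    by (cases u) (simp add: power_mult_distrib power_add mult_ac flip: power_mult)
  have "inj_on v I"
  proof (rule inj_onI)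
    fix u u' assume uu: "u \<in> I" "u' \<in> I" "v u = v u'"
    obtain l j k l' j' k' where "u = (l,j,k)" "u' = (l',j',k')" by (cases u, cases u')
    with uu valuation_injective[OF d(1) Q d(2,3) A d(4), of l l' k k' j j'] show "u = u'"
      by (simp add: I_def v_def)
  qed
  moreover have "poly (G u) \<theta> \<noteq> 0" for u using f(2) unfolding G_def by (cases u) (simp add: poly_power)
  ultimately have \<Psi>0: "\<Psi> \<noteq> 0" unfolding \<Psi>_def Bv using finI c1
    by (intro sum_distinct_valuations_nonzero) auto
  have "[:-x, 1:] ^ M dvd \<Psi>" if x: "x \<in> S" for x
  proof (rule linear_power_dvd_of_coeff_pcompose)
    show "poly f x \<noteq> 0" using x unfolding S_def by simp
    fix i assume i: "i < M"
    have "(\<Sum>u\<in>I. smult (c u) (Z u i)) = 0"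
    proof (rule poly_eqI)
      fix s
      show "coeff (\<Sum>u\<in>I. smult (c u) (Z u i)) s = coeff 0 s"
        using c2[of i s] degZ[of _ i s] i by (cases "s < A + J + i * m") (auto simp: coeff_sum K_def)
    qed
    then have "0 = poly (\<Sum>u\<in>I. smult (c u) (Z u i)) x" by simp
    also have "\<dots> = coeff (pcompose \<Psi> [:x, poly f x:]) i"
      unfolding \<Psi>_def using x i by (simp add: poly_sum pcompose_sum pcompose_smult coeff_sum local)
    finally show "coeff (pcompose \<Psi> [:x, poly f x:]) i = 0" by simp
  qed
  moreover have "finite S"
  proof -
    have "monom 1 Q - [:0, 1:] \<noteq> (0 :: 'b poly)"
    proof
      assume "monom 1 Q - [:0, 1:] = (0 :: 'b poly)"
      then have "coeff (monom 1 Q - [:0, 1:]) Q = (0::'b)" by (metis coeff_0)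
      then show False using Q1 by (simp add: coeff_pCons split: nat.splits)
    qed
    then have "finite {x::'b. poly (monom 1 Q - [:0, 1:]) x = 0}" by (rule poly_roots_finite)
    then show ?thesis unfolding S_def by (rule rev_finite_subset) (auto simp: poly_monom)
  qed
  ultimately have "M * card S \<le> degree \<Psi>" using \<Psi>0 by (intro card_multiple_roots_le)
  also have "degree \<Psi> \<le> Q * (J + m)"
    unfolding \<Psi>_def
  proof (intro degree_sum_le finI)
    fix u assume u: "u \<in> I"
    obtain l j k where ul: "u = (l,j,k)" by (cases u)
    have lt: "l < d" "j < J" "k \<le> A" using u unfolding ul I_def by auto
    have "degree (smult (c u) (B u)) \<le> degree (B u)" by (rule degree_smult_le)
    also have "\<dots> = k + m * E * l + Q * j"
      unfolding B_def ul m_def using f0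
      by (simp add: degree_mult_eq degree_power_eq degree_linear_power)
    also have "\<dots> \<le> E + m * E * (d - 1) + Q * (J - 1)"
      using lt A by (intro add_mono mult_left_mono) auto
    \<comment> \<open>As \<open>m \<ge> 1\<close>, the stray \<open>E\<close> is absorbed by the one
      block \<open>m * E\<close> missing from \<open>d\<close> blocks, and
      \<open>d * E < Q\<close>.\<close>
    also have "\<dots> \<le> m * E + m * E * (d - 1) + Q * (J - 1)" using m1 by simp
    also have "\<dots> = m * (d * E) + Q * (J - 1)" using d(2) by (cases d) (simp_all add: algebra_simps)
    also have "\<dots> \<le> m * Q + Q * J" unfolding d(1) by (intro add_mono mult_left_mono) auto
    finally show "degree (smult (c u) (B u)) \<le> Q * (J + m)" by (simp add: algebra_simps)
  qed
  finally show ?thesis unfolding S_def m_def .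
qed

section \<open>Frobenius and rational polynomials\<close>

lemma freshmans_dream_diff:
  fixes x y :: "'b::comm_ring_1"
  assumes "prime CHAR('b)" "Q = CHAR('b) ^ s"
  shows "(x - y) ^ Q = x ^ Q - y ^ Q"
  using freshmans_dream'[OF assms, of "x - y" y] by (simp add: algebra_simps)

lemma fixed_poly_nonzero:
  assumes "Q > 1"
  shows "monom 1 Q - [:0, 1:] \<noteq> (0 :: 'b::field poly)" "degree (monom 1 Q - [:0, 1:] :: 'b poly) = Q"
proof -
  have "degree (monom 1 Q + - [:0, 1:] :: 'b poly) = degree (monom 1 Q :: 'b poly)"
    using assms by (intro degree_add_eq_left) (simp add: degree_monom_eq)
  then show d: "degree (monom 1 Q - [:0, 1:] :: 'b poly) = Q"
    by (simp only: degree_monom_eq[OF one_neq_zero] diff_conv_add_uminus)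
  show "monom 1 Q - [:0, 1:] \<noteq> (0 :: 'b::field poly)" using d assms by auto
qed

lemma fixed_points_eq_roots: "{x::'b::field. x ^ Q = x} = {x. poly (monom 1 Q - [:0, 1:]) x = 0}"
  by (auto simp: poly_monom)

lemma finite_fixed_points: "Q > 1 \<Longrightarrow> finite {x::'b::field. x ^ Q = x}"
  unfolding fixed_points_eq_roots by (intro poly_roots_finite fixed_poly_nonzero)

lemma card_fixed_points_le: "Q > 1 \<Longrightarrow> card {x::'b::field. x ^ Q = x} \<le> Q"
  unfolding fixed_points_eq_roots
  using card_poly_roots_bound[OF fixed_poly_nonzero(1)] fixed_poly_nonzero(2)[where ?'b = 'b] by metis

lemma size_proots_alg_closed:
  fixes p :: "'b::alg_closed_field poly"
  assumes "p \<noteq> 0"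
  shows "size (proots p) = degree p" "p = smult (lead_coeff p) (\<Prod>x\<in>#proots p. [:-x, 1:])"
proof -
  obtain A where A: "size A = degree p" "p = smult (lead_coeff p) (\<Prod>x\<in>#A. [:-x, 1:])"
    using alg_closed_imp_factorization[OF assms] by auto
  have "proots (\<Prod>x\<in>#A. [:-x, 1:]) = A"
  proof (induction A)
    case (add x A)
    have "(\<Prod>x\<in>#A. [:-x, 1:]) \<noteq> 0" by (auto simp: prod_mset_zero_iff)
    then have "proots ([:-x, 1:] * (\<Prod>x\<in>#A. [:-x, 1:])) = {#x#} + A"
      by (subst proots_mult) (simp_all only: add proots_linear_factor minus_minus pCons_eq_0_iff one_neq_zero simp_thms not_False_eq_True)
    then show ?case by (simp del: mult_pCons_left)
  qed simp
  then have "proots p = A" using assms by (subst A(2)) simp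
  with A show "size (proots p) = degree p" "p = smult (lead_coeff p) (\<Prod>x\<in>#proots p. [:-x, 1:])"
    by auto
qed

text \<open>X^Q - X has derivative -1, hence only simple roots, and over an algebraically closed
  field there are as many as its degree.\<close>

lemma card_fixed_points:
  assumes "prime CHAR('b::alg_closed_field)" "Q = CHAR('b) ^ s" "s > 0"
  shows "card {x::'b. x ^ Q = x} = Q"
proof -
  let ?p = "monom 1 Q - [:0, 1:] :: 'b poly"
  have "CHAR('b) > 1" using assms(1) prime_gt_1_nat by blast
  from one_less_power[OF this assms(3)] have Q: "Q > 1" unfolding assms(2) .
  note p = fixed_poly_nonzero[OF Q, where ?'b = 'b]
  have Q0: "of_nat Q = (0::'b)" unfolding assms(2) using assms(3) by (simp add: zero_power)
  have "pderiv ?p = -1" using Q0 by (simp add: pderiv_diff pderiv_monom pderiv_pCons one_pCons)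
  then have "order x ?p \<le> 1" for x
  proof (cases "poly ?p x = 0")
    case True
    have "\<not> 2 \<le> order x ?p"
    proof
      assume "2 \<le> order x ?p"
      then have "[:-x, 1:] ^ 2 dvd ?p" using p by (simp add: order_divides)
      then obtain r where r: "?p = [:-x, 1:] ^ 2 * r" by (elim dvdE)
      have "poly (pderiv ?p) x = poly (pderiv ([:-x, 1:] * ([:-x, 1:] * r))) x"
        unfolding r by (simp only: power2_eq_square mult.assoc)
      also have "\<dots> = 0" by (simp only: pderiv_mult poly_add poly_mult) simp
      finally have "poly (pderiv ?p) x = 0" .
      with \<open>pderiv ?p = -1\<close> show False by simp
    qed
    then show ?thesis by simp
  qed (simp add: order_0I)
  then have "(\<Sum>x\<in>{x. poly ?p x = 0}. order x ?p) = (\<Sum>x\<in>{x. poly ?p x = 0}. 1)"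
    using p(1) by (intro sum.cong refl antisym) (auto simp: Suc_le_eq order_gt_0_iff simp del: poly_diff)
  moreover have "size (proots ?p) = (\<Sum>x\<in>{x. poly ?p x = 0}. order x ?p)"
    using p by (simp add: size_multiset_overloaded_eq del: poly_diff)
  ultimately show ?thesis
    unfolding fixed_points_eq_roots using size_proots_alg_closed(1)[OF p(1)] p(2) by simp
qed

lemma dvd_of_proots_subset:
  fixes p h :: "'b::alg_closed_field poly"
  assumes "p \<noteq> 0" "h \<noteq> 0" "proots p \<subseteq># proots h"
  shows "p dvd h"
proof -
  have "(\<Prod>x\<in>#proots p. [:-x, 1:]) dvd (\<Prod>x\<in>#proots h. [:-x, 1:])"
    by (intro prod_mset_subset_imp_dvd image_mset_subseteq_mono assms)
  then have "smult (lead_coeff p) (\<Prod>x\<in>#proots p. [:-x, 1:]) dvd smult (lead_coeff h) (\<Prod>x\<in>#proots h. [:-x, 1:])"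
    using assms by (simp add: smult_dvd_iff dvd_smult)
  then show ?thesis using size_proots_alg_closed(2)[OF assms(1)] size_proots_alg_closed(2)[OF assms(2)] by simp
qed

lemma proots_subset_of_dvd:
  fixes p h :: "'b::idom poly"
  assumes "h \<noteq> 0" "p dvd h"
  shows "proots p \<subseteq># proots h"
proof -
  obtain r where r: "h = p * r" using assms by (elim dvdE)
  then show ?thesis using assms by (simp add: proots_mult)
qed

text \<open>The parameter \<open>frob\<close> only serves to fix the type of the field.\<close>

locale frobenius_power =
  fixes frob :: "'b::alg_closed_field \<Rightarrow> 'b" and q s :: nat
  assumes char_prime: "prime CHAR('b)" and q_def: "q = CHAR('b) ^ s" and s_pos: "s > 0"
    and frob_def: "frob x = x ^ q"
begin

lemma q_gt_1: "q > 1"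
  unfolding q_def using one_less_power[OF prime_gt_1_nat[OF char_prime] s_pos] .

lemma q_power: "q ^ k = CHAR('b) ^ (s * k)"
  by (simp add: q_def power_mult)

lemma frob_eq_iff [simp]: "x ^ q = y ^ q \<longleftrightarrow> x = (y::'b)"
proof
  assume "x ^ q = y ^ q"
  then have "(x - y) ^ q = 0" using freshmans_dream_diff[OF char_prime q_def, of x y] by simp
  then show "x = y" by simp
qed simp

definition frob_poly :: "'b poly \<Rightarrow> 'b poly" where "frob_poly = map_poly (\<lambda>c. c ^ q)"

text \<open>The polynomials over the field with \<open>q\<close> elements, expressed without a type
  for that subfield.\<close>

definition rational :: "'b poly \<Rightarrow> bool" where "rational h \<longleftrightarrow> frob_poly h = h"

lemma coeff_frob_poly [simp]: "coeff (frob_poly h) i = coeff h i ^ q"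
  using q_gt_1 by (simp add: frob_poly_def coeff_map_poly)

lemma frob_poly_mult: "frob_poly (h * k) = frob_poly h * frob_poly k"
  by (rule poly_eqI)
    (simp add: coeff_mult freshmans_dream_sum'[OF char_prime q_def] power_mult_distrib)

lemma frob_poly_add: "frob_poly (h + k) = frob_poly h + frob_poly k"
  by (rule poly_eqI) (simp add: freshmans_dream'[OF char_prime q_def])

lemma frob_poly_smult: "frob_poly (smult c h) = smult (c ^ q) (frob_poly h)"
  by (rule poly_eqI) (simp add: power_mult_distrib)

lemma frob_poly_1 [simp]: "frob_poly 1 = 1"
  by (rule poly_eqI) (use q_gt_1 in \<open>auto simp: coeff_1\<close>)

lemma frob_poly_eq_0_iff [simp]: "frob_poly h = 0 \<longleftrightarrow> h = 0"
  using q_gt_1 by (simp add: poly_eq_iff)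

lemma frob_poly_power: "frob_poly (h ^ n) = frob_poly h ^ n"
  by (induction n) (simp_all add: frob_poly_mult)

lemma frob_poly_prod: "frob_poly (\<Prod>i\<in>A. h i) = (\<Prod>i\<in>A. frob_poly (h i))"
  by (induction A rule: infinite_finite_induct) (simp_all add: frob_poly_mult)

lemma frob_poly_linear: "frob_poly [:-x, 1:] = [:-(x ^ q), 1:]"
proof -
  have "(-x) ^ q = -(x ^ q)"
    using freshmans_dream_diff[OF char_prime q_def, of 0 x] q_gt_1 by (simp add: power_0_left)
  then show ?thesis
    by (intro poly_eqI) (use q_gt_1 in \<open>auto simp: coeff_pCons split: nat.splits\<close>)
qed

lemma rational_mult: "rational h \<Longrightarrow> rational k \<Longrightarrow> rational (h * k)"
  by (simp add: rational_def frob_poly_mult)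

lemma rational_cancel: "rational h \<Longrightarrow> rational (h * k) \<Longrightarrow> h \<noteq> 0 \<Longrightarrow> rational k"
  by (simp add: rational_def frob_poly_mult)

lemma poly_frob: "rational h \<Longrightarrow> poly h x ^ q = poly h (x ^ q)"
  unfolding poly_altdef rational_def
  by (simp add: freshmans_dream_sum'[OF char_prime q_def] power_mult_distrib power_commutes
      flip: power_mult) (metis (no_types, lifting) coeff_frob_poly mult.commute)

lemma count_image_mset_frob: "count (image_mset (\<lambda>x::'b. x ^ q) A) (x ^ q) = count A x"
  by (induction A) auto

text \<open>Applying \<open>frob_poly\<close> to a factor [:-x, 1:]^n of \<open>h\<close> shows that
  the multiplicity at x^q is at least that at x. This is one inclusion of multisets, and equal sizes
  make it an equality.\<close>

lemma frob_proots:
  assumes "rational h"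
  shows "image_mset (\<lambda>x. x ^ q) (proots h) = proots h"
proof (cases "h = 0")
  case False
  have "image_mset (\<lambda>x. x ^ q) (proots h) \<subseteq># proots h"
  proof (rule mset_subset_eqI)
    fix y :: 'b
    obtain x where x: "y = x ^ q"
      using nth_root_exists[of q y] q_gt_1 by auto
    have "count (image_mset (\<lambda>x. x ^ q) (proots h)) y = count (proots h) x"
      unfolding x by (rule count_image_mset_frob)
    also have "\<dots> \<le> count (proots h) y"
    proof -
      obtain r where "h = [:-x, 1:] ^ order x h * r"
        using order_1[of x h] by (elim dvdE)
      then have "frob_poly h = frob_poly ([:-x, 1:] ^ order x h * r)" by (rule arg_cong)
      then have "h = [:-y, 1:] ^ order x h * frob_poly r"
        using assms by (simp add: rational_def frob_poly_mult frob_poly_power frob_poly_linear x)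
      then have "[:-y, 1:] ^ order x h dvd h" by (rule dvdI)
      then show ?thesis using False by (simp add: order_divides)
    qed
    finally show "count (image_mset (\<lambda>x. x ^ q) (proots h)) y \<le> count (proots h) y" .
  qed
  then show ?thesis
    by (metis mset_subset_size size_image_mset subset_mset.le_imp_less_or_eq nat_neq_iff)
qed simp

lemma count_proots_frob:
  assumes "rational h"
  shows "count (proots h) (x ^ q) = count (proots h) x"
proof -
  have "count (proots h) (x ^ q) = count (image_mset (\<lambda>x. x ^ q) (proots h)) (x ^ q)"
    using frob_proots[OF assms] by simp
  also have "\<dots> = count (proots h) x" by (rule count_image_mset_frob)
  finally show ?thesis .
qed

lemma count_proots_frob_power:
  assumes "rational h"
  shows "count (proots h) (x ^ q ^ i) = count (proots h) x"
proof (induction i)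
  case (Suc i)
  have "x ^ q ^ Suc i = (x ^ q ^ i) ^ q" by (simp add: mult.commute flip: power_mult)
  then show ?case using count_proots_frob[OF assms, of "x ^ q ^ i"] Suc by simp
qed simp

text \<open>For \<open>k > 0\<close> the subfield with \<open>q ^ k\<close> elements;
  \<open>fixed 0\<close> is everything, whence the recurring condition \<open>k > 0\<close>.\<close>

definition fixed :: "nat \<Rightarrow> 'b set" where "fixed k = {x. x ^ q ^ k = x}"

lemma finite_fixed: "k > 0 \<Longrightarrow> finite (fixed k)"
  unfolding fixed_def using one_less_power[OF q_gt_1] by (intro finite_fixed_points)

lemma card_fixed: "k > 0 \<Longrightarrow> card (fixed k) = q ^ k"
  unfolding fixed_def using s_pos by (intro card_fixed_points[OF char_prime q_power]) simp

lemma frob_power_add: "(x::'b) ^ q ^ (i + j) = (x ^ q ^ i) ^ q ^ j"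
  by (simp add: power_add flip: power_mult)

text \<open>The characteristic polynomial of \<open>x\<close> over the fixed field of \<open>frob\<close>, where \<open>x\<close> is
  regarded as an element of the extension of degree \<open>k\<close>.\<close>

definition charpoly :: "nat \<Rightarrow> 'b \<Rightarrow> 'b poly" where
  "charpoly k x = (\<Prod>i<k. [:-(x ^ q ^ i), 1:])"

lemma charpoly_nonzero [simp]: "charpoly k x \<noteq> 0"
  by (simp add: charpoly_def)

lemma degree_charpoly [simp]: "degree (charpoly k x) = k"
  by (simp add: charpoly_def degree_prod_eq_sum_degree)

lemma monic_charpoly [simp]: "coeff (charpoly k x) k = 1"
  using lead_coeff_prod[of "\<lambda>i. [:-(x ^ q ^ i), 1:]" "{..<k}"] degree_charpoly[of k x]
  by (simp add: charpoly_def)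

lemma rational_charpoly:
  assumes "x \<in> fixed k"
  shows "rational (charpoly k x)"
proof (cases k)
  case 0
  then show ?thesis by (simp add: rational_def charpoly_def)
next
  case (Suc l)
  have "frob_poly (charpoly k x) = (\<Prod>i<k. [:-(x ^ q ^ Suc i), 1:])"
    by (simp add: charpoly_def frob_poly_prod frob_poly_linear mult.commute flip: power_mult)
  also have "\<dots> = (\<Prod>i<l. [:-(x ^ q ^ Suc i), 1:]) * [:-(x ^ q ^ k), 1:]"
    unfolding Suc by simp
  also have "[:-(x ^ q ^ k), 1:] = [:-(x ^ q ^ 0), 1:]" using assms by (simp add: fixed_def)
  also have "(\<Prod>i<l. [:-(x ^ q ^ Suc i), 1:]) * [:-(x ^ q ^ 0), 1:] = charpoly k x"
    unfolding charpoly_def Suc by (subst prod.lessThan_Suc_shift) simp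
  finally show ?thesis unfolding rational_def .
qed

lemma proots_charpoly: "proots (charpoly k x) = image_mset (\<lambda>i. x ^ q ^ i) (mset_set {..<k})"
proof -
  have "proots (charpoly k x) = (\<Sum>i<k. {#x ^ q ^ i#})"
    unfolding charpoly_def by (subst proots_prod) auto
  also have "\<dots> = image_mset (\<lambda>i. x ^ q ^ i) (mset_set {..<k})"
    by (induction k) (auto simp: lessThan_Suc)
  finally show ?thesis .
qed

text \<open>Root multiplicities of both polynomials are invariant under Frobenius, and the roots of
  \<open>charpoly k x\<close> form the single orbit of \<open>x\<close>, so comparing multiplicities
  at \<open>x\<close> suffices.\<close>

lemma charpoly_dvd_iff:
  assumes "x \<in> fixed k" "rational h" "h \<noteq> 0"
  shows "charpoly k x dvd h \<longleftrightarrow> card {i. i < k \<and> x ^ q ^ i = x} \<le> order x h"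
proof -
  have c: "count (proots (charpoly k x)) x = card {i. i < k \<and> x ^ q ^ i = x}"
  proof -
    have "count (proots (charpoly k x)) x = (\<Sum>i\<in>(\<lambda>i. x ^ q ^ i) -` {x} \<inter> {..<k}. 1)"
      unfolding proots_charpoly by (simp add: count_image_mset)
    also have "(\<lambda>i. x ^ q ^ i) -` {x} \<inter> {..<k} = {i. i < k \<and> x ^ q ^ i = x}" by auto
    finally show ?thesis by simp
  qed
  show ?thesis
  proof
    assume "charpoly k x dvd h"
    then have "proots (charpoly k x) \<subseteq># proots h" by (rule proots_subset_of_dvd[OF assms(3)])
    from mset_subset_eq_count[OF this, of x]
    show "card {i. i < k \<and> x ^ q ^ i = x} \<le> order x h" using c assms(3) by (simp del: count_proots flip: count_proots)
  next
    assume le: "card {i. i < k \<and> x ^ q ^ i = x} \<le> order x h"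
    have "proots (charpoly k x) \<subseteq># proots h"
    proof (rule mset_subset_eqI)
      fix y
      show "count (proots (charpoly k x)) y \<le> count (proots h) y"
      proof (cases "y \<in># proots (charpoly k x)")
        case True
        then obtain i where "y = x ^ q ^ i" unfolding proots_charpoly by auto
        then have "count (proots (charpoly k x)) y = count (proots (charpoly k x)) x"
          "count (proots h) y = count (proots h) x"
          using count_proots_frob_power assms(1,2) rational_charpoly by (simp_all del: count_proots)
        then show ?thesis using c le assms(3) by simp
      next
        case False
        then show ?thesis by (metis count_inI zero_le)
      qed
    qed
    then show "charpoly k x dvd h" by (intro dvd_of_proots_subset) (simp_all add: assms)
  qed
qed

end

section \<open>The L-function of a Kummer character\<close>

lemma prod_mset_power: "(\<Prod>x\<in>#A. g x) ^ n = (\<Prod>x\<in>#A. (g x :: 'b::comm_semiring_1) ^ n)"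
  by (induction A) (simp_all add: power_mult_distrib)

text \<open>The resultant of \<open>f\<close> and \<open>h\<close> when \<open>f\<close> is monic and splits.\<close>

definition res :: "'b::idom poly \<Rightarrow> 'b poly \<Rightarrow> 'b" where
  "res f h = (\<Prod>x\<in>#proots f. poly h x)"

lemma res_mult_right: "res f (h * k) = res f h * res f k"
  by (simp add: res_def prod_mset.distrib)

lemma res_1_right [simp]: "res f 1 = 1"
  by (simp add: res_def)

lemma res_prod_right: "res f (\<Prod>i\<in>A. h i) = (\<Prod>i\<in>A. res f (h i))"
  by (induction A rule: infinite_finite_induct) (simp_all add: res_mult_right)

lemma res_mult_left: "f \<noteq> 0 \<Longrightarrow> g \<noteq> 0 \<Longrightarrow> res (f * g) h = res f h * res g h"
  by (simp add: res_def proots_mult)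

lemma res_linear_power: "res ([:-x, 1:] ^ e) h = poly h x ^ e"
  by (induction e) (simp_all add: res_mult_left res_def proots_mult del: mult_pCons_left)

lemma res_linear_right:
  fixes f :: "'b::alg_closed_field poly"
  assumes "lead_coeff f = 1"
  shows "res f [:-y, 1:] = (-1) ^ degree f * poly f y"
proof -
  have f0: "f \<noteq> 0" using assms by auto
  have "poly f y = (\<Prod>x\<in>#proots f. y - x)"
    by (subst size_proots_alg_closed(2)[OF f0]) (simp add: assms poly_prod_mset image_mset.compositionality comp_def)
  moreover have "(\<Prod>x\<in>#A. x - y) = (-1) ^ size A * (\<Prod>x\<in>#A. y - x)" for A
    by (induction A) (simp_all add: algebra_simps)
  ultimately show ?thesis
    using size_proots_alg_closed(1)[OF f0] by (simp add: res_def)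
qed

section \<open>Monic polynomials over the base field and their divisors
  \<open>charpoly k x\<close>\<close>

context frobenius_power
begin

lemma frob_power_eq_iff: "x ^ q ^ i = y ^ q ^ i \<longleftrightarrow> x = (y::'b)"
proof (induction i)
  case (Suc i)
  then show ?case using frob_power_add[of x i 1] frob_power_add[of y i 1] by simp
qed simp

definition monic_rational :: "nat \<Rightarrow> 'b poly set" where
  "monic_rational n = {h. degree h = n \<and> coeff h n = 1 \<and> rational h}"

lemma finite_monic_rational: "finite (monic_rational n)"
proof (rule finite_subset)
  show "monic_rational n \<subseteq> Poly ` {xs. set xs \<subseteq> fixed 1 \<and> length xs = Suc n}"
  proof
    fix h assume "h \<in> monic_rational n"
    then have h: "degree h = n" "h \<noteq> 0" "rational h" by (auto simp: monic_rational_def)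
    have "set (coeffs h) \<subseteq> fixed 1"
    proof
      fix c assume "c \<in> set (coeffs h)"
      then obtain i where "c = coeff h i" by (auto simp: coeffs_def split: if_splits)
      then show "c \<in> fixed 1" using h(3) coeff_frob_poly[of h i] by (simp add: rational_def fixed_def)
    qed
    then show "h \<in> Poly ` {xs. set xs \<subseteq> fixed 1 \<and> length xs = Suc n}"
      using h by (intro image_eqI[of _ _ "coeffs h"]) (auto simp: length_coeffs_degree)
  qed
  show "finite (Poly ` {xs. set xs \<subseteq> fixed 1 \<and> length xs = Suc n})"
    by (intro finite_imageI finite_lists_length_eq finite_fixed) simp
qed

lemma monic_rational_0: "monic_rational 0 = {1}"
proof -
  have "h = 1" if "degree h = 0" "coeff h 0 = 1" for h :: "'b poly"
    using that by (metis degree_0_id one_poly_eq_simps(1))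
  then show ?thesis by (auto simp: monic_rational_def rational_def)
qed

text \<open>The Frobenius orbit of a root stays among the finitely many roots, so two iterates
  agree, and injectivity of Frobenius cancels the earlier one.\<close>

lemma root_in_fixed:
  assumes "rational h" "h \<noteq> 0" "poly h x = 0"
  shows "\<exists>k>0. x \<in> fixed k"
proof -
  have "poly h (x ^ q ^ i) = 0" for i
  proof (induction i)
    case (Suc i)
    have "x ^ q ^ Suc i = (x ^ q ^ i) ^ q" by (simp add: mult.commute flip: power_mult)
    then show ?case using poly_frob[OF assms(1), of "x ^ q ^ i"] q_gt_1 Suc by (simp add: zero_power)
  qed (use assms in simp)
  then have "range (\<lambda>i. x ^ q ^ i) \<subseteq> {y. poly h y = 0}" by auto
  then have "finite (range (\<lambda>i. x ^ q ^ i))"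
    using poly_roots_finite[OF assms(2)] finite_subset by blast
  then have "\<not> inj (\<lambda>i. x ^ q ^ i)" using finite_imageD infinite_UNIV_nat by blast
  then obtain i j where "i < j" "x ^ q ^ i = x ^ q ^ j"
    unfolding inj_def by (metis linorder_neqE_nat)
  moreover from this have "x ^ q ^ j = (x ^ q ^ (j - i)) ^ q ^ i" using frob_power_add[of x "j - i" i] by simp
  ultimately show ?thesis
    using frob_power_eq_iff[of x i "x ^ q ^ (j - i)"] by (intro exI[of _ "j - i"]) (simp add: fixed_def)
qed

lemma fixed_period:
  assumes "\<exists>k>0. x \<in> fixed k"
  obtains p where "p > 0" "\<And>k. x \<in> fixed k \<longleftrightarrow> p dvd k"
proof -
  define p where "p = (LEAST k. k > 0 \<and> x \<in> fixed k)"
  have p: "p > 0" "x \<in> fixed p"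
    using LeastI_ex[of "\<lambda>k. k > 0 \<and> x \<in> fixed k"] assms unfolding p_def by auto
  have least: "k = 0" if "x \<in> fixed k" "k < p" for k
    using not_less_Least[of k "\<lambda>k. k > 0 \<and> x \<in> fixed k"] that unfolding p_def by auto
  have m: "x ^ q ^ (p * j) = x" for j
  proof (induction j)
    case (Suc j)
    then show ?case using p(2) frob_power_add[of x "p * j" p] by (simp add: fixed_def add.commute)
  qed simp
  have "x \<in> fixed k \<longleftrightarrow> p dvd k" for k
  proof -
    have "x ^ q ^ k = x ^ q ^ (k mod p)"
      using frob_power_add[of x "p * (k div p)" "k mod p"] m by simp
    then show ?thesis
      using least[of "k mod p"] p(1) by (auto simp: fixed_def mod_eq_0_iff_dvd dvd_imp_mod_0)
  qed
  with p(1) show ?thesis using that by blast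
qed

text \<open>If \<open>x\<close> has period \<open>p\<close>, the admissible \<open>k\<close> are the
  multiples \<open>p * j\<close>, and \<open>charpoly (p * j) x\<close> contains every conjugate of
  \<open>x\<close> exactly \<open>j\<close> times; it divides \<open>h\<close> iff \<open>j\<close>
  is at most the multiplicity of \<open>x\<close>.\<close>

lemma card_charpoly_power_dvd:
  assumes "rational h" "h \<noteq> 0" "poly h x = 0"
  shows "card {k. k > 0 \<and> x \<in> fixed k \<and> charpoly k x dvd h} = order x h"
    "finite {k. k > 0 \<and> x \<in> fixed k \<and> charpoly k x dvd h}"
proof -
  obtain p where p: "p > 0" "\<And>k. x \<in> fixed k \<longleftrightarrow> p dvd k"
    using fixed_period root_in_fixed[OF assms] by metis
  have eq: "{k. k > 0 \<and> x \<in> fixed k \<and> charpoly k x dvd h} = (\<lambda>j. p * j) ` {1..order x h}"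
  proof -
    have *: "charpoly (p * j) x dvd h \<longleftrightarrow> j \<le> order x h" for j
    proof -
      have "{i. i < p * j \<and> x ^ q ^ i = x} = (\<lambda>i. p * i) ` {..<j}"
        using p unfolding fixed_def by (auto simp: dvd_def)
      then have "card {i. i < p * j \<and> x ^ q ^ i = x} = j"
        using p(1) by (simp add: card_image inj_on_def)
      then show ?thesis using charpoly_dvd_iff[of x "p * j" h] p(2) assms by simp
    qed
    show ?thesis unfolding p(2)
    proof (intro Set.set_eqI iffI)
      fix k assume k: "k \<in> {k. k > 0 \<and> p dvd k \<and> charpoly k x dvd h}"
      then obtain j where "k = p * j" by (auto simp: dvd_def)
      then show "k \<in> (\<lambda>j. p * j) ` {1..order x h}" using k * by auto
    next
      fix k assume "k \<in> (\<lambda>j. p * j) ` {1..order x h}"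
      then obtain j where "k = p * j" "j \<in> {1..order x h}" by blast
      then show "k \<in> {k. k > 0 \<and> p dvd k \<and> charpoly k x dvd h}" using * p(1) by simp
    qed
  qed
  show "card {k. k > 0 \<and> x \<in> fixed k \<and> charpoly k x dvd h} = order x h"
    unfolding eq using p(1) by (simp add: card_image inj_on_def)
  show "finite {k. k > 0 \<and> x \<in> fixed k \<and> charpoly k x dvd h}" unfolding eq by simp
qed

lemma card_charpoly_divisors:
  assumes "rational h" "h \<noteq> 0"
  shows "card (SIGMA x:{x. poly h x = 0}. {k. k > 0 \<and> x \<in> fixed k \<and> charpoly k x dvd h}) = degree h"
    "finite (SIGMA x:{x. poly h x = 0}. {k. k > 0 \<and> x \<in> fixed k \<and> charpoly k x dvd h})"
proof -
  have fin: "finite {x. poly h x = 0}" by (rule poly_roots_finite[OF assms(2)])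
  have "card (SIGMA x:{x. poly h x = 0}. {k. k > 0 \<and> x \<in> fixed k \<and> charpoly k x dvd h})
      = (\<Sum>x | poly h x = 0. order x h)"
    using fin card_charpoly_power_dvd[OF assms] by (subst card_SigmaI) auto
  also have "\<dots> = size (proots h)" using assms(2) by (simp add: size_multiset_overloaded_eq)
  finally show "card (SIGMA x:{x. poly h x = 0}. {k. k > 0 \<and> x \<in> fixed k \<and> charpoly k x dvd h}) = degree h"
    using size_proots_alg_closed(1)[OF assms(2)] by simp
  show "finite (SIGMA x:{x. poly h x = 0}. {k. k > 0 \<and> x \<in> fixed k \<and> charpoly k x dvd h})"
    using fin card_charpoly_power_dvd(2)[OF assms] by (intro finite_SigmaI) auto
qed

lemma frob_res:
  assumes "rational f" "rational h"
  shows "res f h ^ q = res f h"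
proof -
  have "res f h ^ q = (\<Prod>x\<in>#proots f. poly h (x ^ q))"
    unfolding res_def by (simp add: prod_mset_power poly_frob[OF assms(2)])
  also have "\<dots> = (\<Prod>x\<in>#image_mset (\<lambda>x. x ^ q) (proots f). poly h x)"
    by (simp add: image_mset.compositionality comp_def)
  also have "\<dots> = res f h" unfolding frob_proots[OF assms(1)] res_def ..
  finally show ?thesis .
qed

text \<open>The exponent 1 + q + ... + q^(k-1) is that of the norm to the base field, so up to sign
  the resultant is the norm of f(x). The sign stays inside because -1 is fixed by Frobenius.\<close>

lemma res_charpoly:
  assumes "rational f" "lead_coeff f = 1"
  shows "res f (charpoly k x) = ((-1) ^ degree f * poly f x) ^ (\<Sum>i<k. q ^ i)"
proof -
  have m1: "(-1::'b) ^ q ^ i = -1" for i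
    using freshmans_dream_diff[OF char_prime q_power, of 0 1 i] q_gt_1 by (simp add: power_0_left)
  have pf: "poly f (x ^ q ^ i) = poly f x ^ q ^ i" for i
  proof (induction i)
    case (Suc i)
    have "poly f (x ^ q ^ Suc i) = poly f (x ^ q ^ i) ^ q"
      by (simp add: poly_frob[OF assms(1)] mult.commute flip: power_mult)
    then show ?case using Suc by (simp add: mult.commute flip: power_mult)
  qed simp
  have "res f (charpoly k x) = (\<Prod>i<k. (-1) ^ degree f * poly f (x ^ q ^ i))"
    unfolding charpoly_def res_prod_right res_linear_right[OF assms(2)] ..
  also have "\<dots> = (\<Prod>i<k. ((-1) ^ degree f * poly f x) ^ q ^ i)"
  proof (intro prod.cong refl)
    fix i
    have "((-1::'b) ^ degree f) ^ q ^ i = (-1) ^ degree f"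
      by (metis m1 power_commutes power_mult mult.commute)
    then show "(-1) ^ degree f * poly f (x ^ q ^ i) = ((-1) ^ degree f * poly f x) ^ q ^ i"
      by (simp add: pf power_mult_distrib)
  qed
  also have "\<dots> = ((-1) ^ degree f * poly f x) ^ (\<Sum>i<k. q ^ i)" by (simp add: power_sum)
  finally show ?thesis .
qed

lemma rational_linear: "x \<in> fixed 1 \<Longrightarrow> rational [:-x, 1:]"
  by (simp add: rational_def frob_poly_linear fixed_def)

end

text \<open>
  \<open>\<psi>\<close> is the character of the \<open>d\<close>-th roots of unity through which \<open>\<chi>\<close> factors; in the
  extension of degree \<open>k\<close>, where \<open>\<chi>\<close> is composed with the norm, it allows sorting the summands
  by a power of \<open>f(x)\<close>.
\<close>

locale kummer_sum = frobenius_power frob q s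
  for frob :: "'b::alg_closed_field \<Rightarrow> 'b" and q s :: nat +
  fixes f g :: "'b poly" and \<theta> :: 'b and e d E :: nat and \<chi> \<psi> :: "'b \<Rightarrow> complex"
  assumes f_eq: "f = [:-\<theta>, 1:] ^ e * g" and g_\<theta>: "poly g \<theta> \<noteq> 0" and \<theta>_fixed: "\<theta> \<in> fixed 1"
    and f_rational: "rational f" and f_monic: "lead_coeff f = 1"
    and e_pos: "e > 0" and d_pos: "d > 0" and coprime_e_d: "coprime e d" and d_E: "d * E = q - 1"
    and \<chi>_0: "\<chi> 0 = 0" and \<chi>_1: "\<chi> 1 = 1"
    and \<chi>_mult: "\<And>x y. x \<in> fixed 1 \<Longrightarrow> y \<in> fixed 1 \<Longrightarrow> \<chi> (x * y) = \<chi> x * \<chi> y"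
    and \<chi>_\<psi>: "\<And>x. x \<in> fixed 1 \<Longrightarrow> x \<noteq> 0 \<Longrightarrow> \<chi> x = \<psi> (x ^ E)"
    and norm_\<psi>: "\<And>\<omega>. \<omega> ^ d = 1 \<Longrightarrow> cmod (\<psi> \<omega>) \<le> 1"
    and sum_\<psi>: "(\<Sum>\<omega> | \<omega> ^ d = 1. \<psi> \<omega>) = 0"
    and \<chi>_nontrivial: "\<exists>u\<in>fixed 1. u \<noteq> 0 \<and> \<chi> (u ^ e) \<noteq> 1"
begin

text \<open>Coefficients of the L-function as a power series; \<open>\<chi> (res f h)\<close> is
  multiplicative in \<open>h\<close>.\<close>

definition L_coeff :: "nat \<Rightarrow> complex" where
  "L_coeff n = (\<Sum>h\<in>monic_rational n. \<chi> (res f h))"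

text \<open>The character sum over the extension of degree k, with \<chi> composed with the norm;
  the resultant provides the norm.\<close>

definition char_sum :: "nat \<Rightarrow> complex" where
  "char_sum k = (\<Sum>x\<in>fixed k. \<chi> (res f (charpoly k x)))"

lemma L_coeff_0: "L_coeff 0 = 1"
  by (simp add: L_coeff_def monic_rational_0 \<chi>_1)

text \<open>
  The logarithmic derivative of the Euler product: every \<open>h\<close> of degree \<open>n\<close> is counted \<open>n\<close> times, once
  for each pair \<open>(x, k)\<close> such that \<open>charpoly k x\<close> divides \<open>h\<close>.
\<close>

lemma L_recurrence: "of_nat n * L_coeff n = (\<Sum>k=1..n. char_sum k * L_coeff (n - k))"
proof -
  define T where "T h = (SIGMA x:{x. poly h x = 0}. {k. k > 0 \<and> x \<in> fixed k \<and> charpoly k x dvd h})" for h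
  have mr: "rational h" "h \<noteq> 0" "degree h = n" if "h \<in> monic_rational n" for h n
    using that by (auto simp: monic_rational_def)
  have "(\<Sum>k=1..n. char_sum k * L_coeff (n - k)) =
      (\<Sum>k=1..n. \<Sum>x\<in>fixed k. \<Sum>h\<in>monic_rational (n - k). \<chi> (res f (charpoly k x * h)))"
    unfolding char_sum_def L_coeff_def sum_product
    by (intro sum.cong refl, subst \<chi>_mult[symmetric])
      (auto simp: res_mult_right fixed_def frob_res[OF f_rational] rational_charpoly[unfolded fixed_def] mr)
  also have "\<dots> = (\<Sum>(k, x, h)\<in>(SIGMA k:{1..n}. fixed k \<times> monic_rational (n - k)). \<chi> (res f (charpoly k x * h)))"
    using finite_fixed finite_monic_rational
    by (subst sum.Sigma[symmetric]) (auto simp: sum.cartesian_product intro!: sum.cong)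
  also have "\<dots> = (\<Sum>(h, x, k)\<in>(SIGMA h:monic_rational n. T h). \<chi> (res f h))"
  \<comment> \<open>A pair (divisor, cofactor) is exchanged for the product marked with its divisor;
    the marks on \<open>h\<close> are what \<open>T h\<close> collects, \<open>n\<close> of
    them.\<close>
  proof (rule sum.reindex_bij_witness[where
      j = "\<lambda>(k, x, h). (charpoly k x * h, x, k)" and i = "\<lambda>(h, x, k). (k, x, h div charpoly k x)"], goal_cases)
    case (1 a)
    then show ?case by (auto)
  next
    case (2 a)
    then obtain k x h where a: "a = (k, x, h)" "1 \<le> k" "k \<le> n" "x \<in> fixed k" "h \<in> monic_rational (n - k)"
      by auto
    have "poly (charpoly k x) x = 0" using a(2) unfolding charpoly_def poly_prod
      by (intro prod_zero) (auto intro!: bexI[of _ 0])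
    moreover have "charpoly k x * h \<in> monic_rational n"
      using a coeff_mult_degree_sum[of "charpoly k x" h]
      by (auto simp: monic_rational_def degree_mult_eq rational_mult rational_charpoly mr(2))
    ultimately show ?case using a unfolding T_def by auto
  next
    case (3 b)
    then show ?case unfolding T_def by auto
  next
    case (4 b)
    then obtain h x k where b: "b = (h, x, k)" "h \<in> monic_rational n" "poly h x = 0" "k > 0" "x \<in> fixed k"
      "charpoly k x dvd h" unfolding T_def by auto
    then obtain r where r: "h = charpoly k x * r" by (elim dvdE)
    have r0: "r \<noteq> 0" using mr(2)[OF b(2)] r by auto
    have deg: "n = k + degree r" using mr(3)[OF b(2)] r0 unfolding r by (simp add: degree_mult_eq)
    have "coeff r (n - k) = 1"
      using b(2) coeff_mult_degree_sum[of "charpoly k x" r] unfolding r deg by (simp add: monic_rational_def)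
    moreover have "rational r"
      using rational_cancel[of "charpoly k x" r] rational_charpoly[OF b(5)] mr(1)[OF b(2)] unfolding r by simp
    ultimately show ?case using b deg unfolding r by (auto simp: monic_rational_def)
  next
    case (5 a)
    then show ?case by auto
  qed
  also have "\<dots> = (\<Sum>h\<in>monic_rational n. \<Sum>(x, k)\<in>T h. \<chi> (res f h))"
    using finite_monic_rational card_charpoly_divisors(2)[OF mr(1,2)]
    by (subst sum.Sigma) (auto simp: T_def case_prod_unfold)
  also have "\<dots> = (\<Sum>h\<in>monic_rational n. of_nat n * \<chi> (res f h))"
    using card_charpoly_divisors(1)[OF mr(1,2)] mr(3)
    by (intro sum.cong refl) (simp add: T_def case_prod_unfold)
  also have "\<dots> = of_nat n * L_coeff n" by (simp add: L_coeff_def sum_distrib_left)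
  finally show ?thesis ..
qed

lemma g_nonzero: "g \<noteq> 0" using g_\<theta> by auto

lemma degree_f: "degree f = e + degree g"
  using g_nonzero by (simp add: f_eq degree_mult_eq degree_linear_power)

lemma rational_g: "rational g"
proof -
  have "rational ([:-\<theta>, 1:] ^ e)"
    using rational_linear[OF \<theta>_fixed] by (simp add: rational_def frob_poly_power)
  then show ?thesis using rational_cancel[of "[:-\<theta>, 1:] ^ e" g] f_rational by (simp add: f_eq)
qed

text \<open>
  Adding a multiple of \<open>g\<close> to \<open>h\<close> changes the value of \<open>h\<close> at \<open>\<theta>\<close> by an arbitrary factor \<open>u\<close> but not its values
  at the roots of \<open>g\<close>. So \<open>\<chi> (u\<^sup>e)\<close> times the sum equals the sum.
\<close>

lemma L_coeff_eq_0:
  assumes "n \<ge> degree f"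
  shows "L_coeff n = 0"
proof -
  obtain u where u: "u \<in> fixed 1" "u \<noteq> 0" "\<chi> (u ^ e) \<noteq> 1" using \<chi>_nontrivial by auto
  have fx: "x + y \<in> fixed 1" "x * y \<in> fixed 1" "x - y \<in> fixed 1" "inverse x \<in> fixed 1" "x ^ n \<in> fixed 1"
    if "x \<in> fixed 1" "y \<in> fixed 1" for x y n
    using that freshmans_dream'[OF char_prime q_def, of x y] freshmans_dream_diff[OF char_prime q_def, of x y]
    by (auto simp: fixed_def power_mult_distrib power_inverse mult.commute[of n q] power_mult)
      (metis mult.commute power_mult)
  have one: "1 \<in> fixed 1" by (simp add: fixed_def)
  have pg: "poly g \<theta> \<in> fixed 1" and ph: "\<And>h. rational h \<Longrightarrow> poly h \<theta> \<in> fixed 1"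
    using poly_frob rational_g \<theta>_fixed by (auto simp: fixed_def)
  \<comment> \<open>\<open>w\<close> is \<open>g\<close> scaled to take the value 1 at \<theta>.
    Since \<open>e > 0\<close>, its degree is below \<open>degree f \<le> n\<close>, so
    \<open>move u h\<close> remains monic of degree \<open>n\<close>.\<close>
  define w where "w = smult (inverse (poly g \<theta>)) g"
  define move where "move u h = h + smult ((u - 1) * poly h \<theta>) w" for u h
  have w: "poly w \<theta> = 1" using g_\<theta> by (simp add: w_def)
  have rw: "rational (smult c w)" if "c \<in> fixed 1" for c
    using fx[OF pg pg] that rational_g unfolding w_def
    by (simp add: rational_def frob_poly_smult fixed_def power_mult_distrib)
  have poly_move: "poly (move u h) \<theta> = u * poly h \<theta>" for u h
    using w by (simp add: move_def algebra_simps)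
  have mem: "move u h \<in> monic_rational n" if "u \<in> fixed 1" "h \<in> monic_rational n" for u h
  proof -
    have h: "degree h = n" "coeff h n = 1" "rational h" using that(2) by (auto simp: monic_rational_def)
    have "degree (smult ((u - 1) * poly h \<theta>) w) \<le> degree g"
      unfolding w_def by (intro order.trans[OF degree_smult_le] order.refl)
    then have lt: "degree (smult ((u - 1) * poly h \<theta>) w) < n"
      using assms degree_f e_pos by linarith
    moreover have "rational (move u h)"
      using h(3) rw[of "(u - 1) * poly h \<theta>"] fx that(1) one ph
      by (simp add: rational_def move_def frob_poly_add)
    moreover have "degree (move u h) = n" unfolding move_def using lt h(1) by (subst degree_add_eq_left) auto
    moreover have "coeff (move u h) n = 1"
      unfolding move_def coeff_add using coeff_eq_0[OF lt] h(2) by (simp only: add_0_right)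
    ultimately show ?thesis by (simp add: monic_rational_def)
  qed
  have inv: "move v (move u h) = h" if "u * v = 1" for u v h
  proof -
    have "(u - 1) * poly h \<theta> + (v - 1) * (u * poly h \<theta>) = 0"
      using that by (simp add: algebra_simps)
    then have "smult ((u - 1) * poly h \<theta>) w + smult ((v - 1) * (u * poly h \<theta>)) w = 0"
      by (simp flip: smult_add_left)
    then show ?thesis unfolding move_def[of v] poly_move by (simp add: move_def add.assoc)
  qed
  have res: "res f (move u h) = u ^ e * res f h" for h
  proof -
    have "poly (move u h) x = poly h x" if "x \<in># proots g" for x
      using that g_nonzero by (simp add: move_def w_def)
    then have "res g (move u h) = res g h"
      unfolding res_def by (intro arg_cong[of _ _ prod_mset] image_mset_cong)
    then show ?thesis unfolding f_eq
      using g_nonzero by (simp add: res_mult_left res_linear_power poly_move power_mult_distrib)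
  qed
  have "L_coeff n = (\<Sum>h\<in>monic_rational n. \<chi> (res f (move u h)))"
    unfolding L_coeff_def
    by (rule sum.reindex_bij_witness[of _ "move u" "move (inverse u)"])
      (use u mem fx(4) inv[of u "inverse u"] inv[of "inverse u" u] in auto)
  also have "\<dots> = (\<Sum>h\<in>monic_rational n. \<chi> (u ^ e) * \<chi> (res f h))"
    unfolding res using fx(5)[OF u(1) u(1)] frob_res[OF f_rational]
    by (intro sum.cong refl \<chi>_mult) (auto simp: monic_rational_def fixed_def)
  also have "\<dots> = \<chi> (u ^ e) * L_coeff n" by (simp add: L_coeff_def sum_distrib_left)
  finally show ?thesis using u(3) by (metis mult_cancel_right1)
qed

end

section \<open>Weil's bound\<close>

text \<open>The order of quantifiers matters: \<open>C\<close> precedes \<open>Q\<close>, so one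
  constant serves every extension. With J near sqrt Q and M = d (J - c), the quotient Q (J + m) / M
  is Q / d plus an error of order sqrt Q.\<close>

lemma stepanov_bound:
  fixes f g :: "'b::field poly" and \<theta> :: 'b
  assumes char: "prime CHAR('b)"
    and f: "f = [:-\<theta>, 1:] ^ e * g" "poly g \<theta> \<noteq> 0"
    and d: "d > 0" "coprime e d" "e > 0"
  shows "\<exists>C\<ge>0. \<forall>Q s E \<omega>. Q = CHAR('b) ^ s \<longrightarrow> Q > 1 \<longrightarrow> \<theta> ^ Q = \<theta> \<longrightarrow> d * E = Q - 1 \<longrightarrow>
    real (card {x. x ^ Q = x \<and> poly f x \<noteq> 0 \<and> poly f x ^ E = \<omega>}) \<le> real Q / real d + C * sqrt (real Q)"
proof -
  define m where "m = degree f"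
  define B where "B = 1 + d * m"
  \<comment> \<open>Lowering \<open>M / d\<close> from \<open>J\<close> by \<open>c\<close> leaves a
    surplus \<open>c * (A + 1)\<close> of unknowns; the factor 2 * d * B makes it pay for the
    conditions beyond \<open>M * A\<close>, at most \<open>d * Q * B\<close>.\<close>
  define c where "c = 2 * d * B"
  \<comment> \<open>For \<open>J \<ge> N\<close> both \<open>n \<ge> c\<close> and
    \<open>2 * d * e \<le> Q\<close> hold; below \<open>N\<close> the trivial bound Q is already
    O(sqrt Q).\<close>
  define N where "N = 2 * c + 2 * d * e"
  have bound: "real (card {x. x ^ Q = x \<and> poly f x \<noteq> 0 \<and> poly f x ^ E = \<omega>})
      \<le> real Q / real d + (real N + 1 + 4 * real (c + m)) * sqrt (real Q)"
    if Q: "Q = CHAR('b) ^ s" "Q > 1" and \<theta>: "\<theta> ^ Q = \<theta>" and dE: "d * E = Q - 1" for Q s E \<omega>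
  proof -
    define S where "S = {x. x ^ Q = x \<and> poly f x \<noteq> 0 \<and> poly f x ^ E = \<omega>}"
    define J where "J = nat \<lfloor>sqrt (real Q)\<rfloor>"
    have Jle: "real J \<le> sqrt (real Q)" and Jgt: "sqrt (real Q) < real J + 1"
      unfolding J_def by (auto simp: le_nat_iff)
    have "real J ^ 2 \<le> sqrt (real Q) ^ 2" using Jle by (intro power_mono) auto
    then have "real (J ^ 2) \<le> real Q" by simp
    then have JQ: "J * J \<le> Q" unfolding of_nat_le_iff power2_eq_square .
    have sq: "sqrt (real Q) * sqrt (real Q) = real Q" by simp
    show ?thesis
    proof (cases "J \<ge> N")
      case False
      have "card S \<le> card {x::'b. x ^ Q = x}"
        unfolding S_def using finite_fixed_points[OF Q(2)] by (intro card_mono) auto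
      also have "\<dots> \<le> Q" by (rule card_fixed_points_le[OF Q(2)])
      finally have "real (card S) \<le> sqrt (real Q) * sqrt (real Q)" by simp
      also have "\<dots> \<le> (real N + 1 + 4 * real (c + m)) * sqrt (real Q)"
        using Jgt False by (intro mult_right_mono) auto
      finally have "real (card S) \<le> (real N + 1 + 4 * real (c + m)) * sqrt (real Q)" .
      moreover have "0 \<le> real Q / real d" by simp
      ultimately show ?thesis unfolding S_def by linarith
    next
      case True
      have c0: "c > 0" "c \<ge> d" using d(1) by (auto simp: c_def B_def)
      define n where "n = J - c"
      have Jn: "J = n + c" and n: "n > 0" "n \<ge> c" using True c0 by (auto simp: n_def N_def)
      have QJ: "Q \<ge> J"
        using JQ le_square[of J] by linarith
      have Qde: "2 * (d * e) \<le> Q" using True QJ unfolding N_def by linarith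
      have "d * e \<le> d * E" using Qde Q(2) dE by linarith
      then have eE: "e \<le> E" using d(1) by simp
      \<comment> \<open>The largest value that the separation of valuations permits.\<close>
      define A where "A = E - e"
      have dA: "d * (A + 1) + d * e = d * E + d"       proof -
        have "E = A + e" using eE by (simp add: A_def)
        then show ?thesis by (simp add: algebra_simps)
      qed
      have QA: "Q \<le> 2 * (d * (A + 1))" using dA dE Qde d(1) Q(2) by linarith
      define M where "M = d * n"
      have MJ: "M \<le> d * J" unfolding M_def Jn by simp
      have "(\<Sum>i<M. A + J + i * m) \<le> (\<Sum>i<M. A + J + d * J * m)"
        using MJ by (intro sum_mono add_mono mult_right_mono) auto
      also have "\<dots> = d * (n * (A + J * B))" by (simp add: M_def B_def algebra_simps)
      also have "\<dots> < d * (J * (A + 1))"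
      proof -
        have "n * (J * B) \<le> J * J * B" using Jn by (simp add: algebra_simps)
        also have "\<dots> \<le> Q * B" using JQ by (intro mult_right_mono) auto
        also have "\<dots> \<le> 2 * (d * (A + 1)) * B" using QA by (intro mult_right_mono) auto
        also have "\<dots> = c * (A + 1)" by (simp add: c_def algebra_simps)
        finally have "n * (J * B) \<le> c * (A + 1)" .
        moreover have "J * (A + 1) = n * A + n + c * (A + 1)" by (simp add: Jn algebra_simps)
        moreover have "n * (A + J * B) = n * A + n * (J * B)" by (simp add: algebra_simps)
        ultimately have "n * (A + J * B) < J * (A + 1)" using n(1) by linarith
        then show ?thesis using d(1) by simp
      qed
      finally have count: "(\<Sum>i<M. A + J + i * degree f) < d * J * (A + 1)" by (simp only: m_def mult.assoc)
      have "M \<le> J * J" using MJ c0(2) Jn by (intro order.trans[OF MJ] mult_right_mono) auto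
      then have "M \<le> Q" using JQ by simp
      then have "M * card S \<le> Q * (J + m)"
        unfolding S_def m_def using A_def eE
        by (intro stepanov_auxiliary[OF char Q(1) f \<theta> dE d _ _ count]) auto
      then have "real (M * card S) \<le> real (Q * (J + m))" by (simp only: of_nat_le_iff)
      then have "real d * real n * real (card S) \<le> real Q * (real J + real m)" by (simp add: M_def)
      then have "real (card S) \<le> real Q * (real J + real m) / (real d * real n)"
        using d(1) n(1) by (simp add: field_simps)
      also have "\<dots> = real Q / real d + real Q * real (c + m) / (real d * real n)"
        using d(1) n(1) by (simp add: Jn field_simps)
      also have "real Q * real (c + m) / (real d * real n) \<le> real Q * real (c + m) / real n"
      proof -
        have "1 * real n \<le> real d * real n" using d(1) by (intro mult_right_mono) auto
        then show ?thesis using n(1) d(1) by (intro divide_left_mono) auto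
      qed
      also have "\<dots> = sqrt (real Q) * real (c + m) * (sqrt (real Q) / real n)" using sq by (simp add: mult.assoc mult.left_commute)
      \<comment> \<open>From \<open>n \<ge> c\<close> and \<open>n \<ge> 1\<close>: sqrt Q < n + c +
        1 <= 4 n.\<close>
      also have "\<dots> \<le> sqrt (real Q) * real (c + m) * 4"
        using n Jgt by (intro mult_left_mono) (auto simp: Jn divide_simps)
      also have "real Q / real d + \<dots> \<le> real Q / real d + (real N + 1 + 4 * real (c + m)) * sqrt (real Q)"
        by (simp add: algebra_simps)
      finally show ?thesis unfolding S_def by simp
    qed
  qed
  show ?thesis
    by (intro exI[of _ "real N + 1 + 4 * real (c + m)"] conjI allI impI bound) auto
qed

section \<open>From bounds on power sums to bounds on inverse roots\<close>

text \<open>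
  The other members of \<open>A\<close> are removed by applying to the sequence of power sums the shift
  operator whose characteristic polynomial \<open>\<rho>\<close> vanishes at all of them.
\<close>

lemma dominated_power_sums:
  fixes A :: "complex multiset"
  assumes r: "r > 0" and bound: "\<And>k. k > 0 \<Longrightarrow> cmod (\<Sum>\<alpha>\<in>#A. \<alpha> ^ k) \<le> C * r ^ k"
    and \<beta>: "\<beta> \<in># A"
  shows "cmod \<beta> \<le> r"
proof (rule ccontr)
  assume "\<not> cmod \<beta> \<le> r"
  then have gt: "cmod \<beta> / r > 1" using r by simp
  define \<rho> where "\<rho> = (\<Prod>b\<in>set_mset A - {\<beta>}. [:-b, 1:])"
  have \<rho>\<beta>: "poly \<rho> \<beta> \<noteq> 0" by (auto simp: \<rho>_def poly_prod)
  have \<rho>0: "poly \<rho> b = 0" if "b \<in># A" "b \<noteq> \<beta>" for b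
    unfolding \<rho>_def poly_prod using that by (intro prod_zero) auto
  define w where "w = cmod (of_nat (count A \<beta>) * poly \<rho> \<beta>)"
  have w: "w > 0" using \<beta> \<rho>\<beta> by (simp add: w_def)
  define C' where "C' = (\<Sum>j\<le>degree \<rho>. cmod (coeff \<rho> j) * (C * r ^ j))"
  have "w * cmod \<beta> ^ k \<le> C' * r ^ k" if k: "k > 0" for k
  proof -
    have "(\<Sum>j\<le>degree \<rho>. coeff \<rho> j * (\<Sum>\<alpha>\<in>#A. \<alpha> ^ (k + j))) = (\<Sum>\<alpha>\<in>#A. \<alpha> ^ k * poly \<rho> \<alpha>)"
      unfolding poly_altdef
      by (induction A) (simp_all add: sum.distrib distrib_left sum_distrib_left power_add mult_ac)
    also have "\<dots> = (\<Sum>\<alpha>\<in>#A. if \<alpha> = \<beta> then \<beta> ^ k * poly \<rho> \<beta> else 0)"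
      by (intro arg_cong[of _ _ sum_mset] image_mset_cong) (auto simp: \<rho>0)
    also have "\<dots> = of_nat (count A \<beta>) * (\<beta> ^ k * poly \<rho> \<beta>)"
      by (induction A) (simp_all add: algebra_simps)
    finally have "w * cmod \<beta> ^ k = cmod (\<Sum>j\<le>degree \<rho>. coeff \<rho> j * (\<Sum>\<alpha>\<in>#A. \<alpha> ^ (k + j)))"
      by (simp add: w_def norm_mult norm_power)
    also have "\<dots> \<le> (\<Sum>j\<le>degree \<rho>. cmod (coeff \<rho> j) * (C * r ^ (k + j)))"
      using bound k by (intro order.trans[OF norm_sum] sum_mono) (simp add: norm_mult mult_left_mono)
    also have "\<dots> = C' * r ^ k" by (simp add: C'_def sum_distrib_left sum_distrib_right power_add mult_ac)
    finally show ?thesis .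
  qed
  then have le: "(cmod \<beta> / r) ^ k \<le> C' / w" if "k > 0" for k
    using that w r by (simp add: power_divide field_simps)
  obtain k where "C' / w < (cmod \<beta> / r) ^ k" using real_arch_pow[OF gt] by blast
  then have "C' / w < (cmod \<beta> / r) ^ Suc k"
    using power_strict_increasing[OF lessI gt, of k] by (rule less_trans)
  with le[of "Suc k"] show False by simp
qed

text \<open>Newton's identities as a generating function: logarithmic derivatives add over the
  factors 1 - \<alpha> X, and each contributes a geometric series without its constant term, hence
  the value 0 at \<open>k = 0\<close>.\<close>

lemma newton_power_sums_fps:
  fixes A :: "'a::field multiset"
  shows "fps_X * fps_deriv (fps_of_poly (\<Prod>\<alpha>\<in>#A. [:1, -\<alpha>:])) =
    - (Abs_fps (\<lambda>k. if k = 0 then 0 else (\<Sum>\<alpha>\<in>#A. \<alpha> ^ k)) * fps_of_poly (\<Prod>\<alpha>\<in>#A. [:1, -\<alpha>:]))"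
proof (induction A)
  case empty
  have "Abs_fps (\<lambda>k. if k = 0 then 0 else (\<Sum>\<alpha>\<in>#{#}. \<alpha> ^ k)) = (0::'a fps)" by (simp add: fps_eq_iff)
  then show ?case by (simp only: image_mset_empty prod_mset_empty) simp
next
  case (add a A)
  let ?D = "fps_of_poly (\<Prod>\<alpha>\<in>#A. [:1, -\<alpha>:])" and ?l = "fps_of_poly [:1, -a:]"
  define p where "p = Abs_fps (\<lambda>k. if k = 0 then 0 else (\<Sum>\<alpha>\<in>#A. \<alpha> ^ k))"
  define pa where "pa = Abs_fps (\<lambda>k. if k = 0 then 0 else a ^ k)"
  have l: "?l = 1 - fps_const a * fps_X" by (simp add: fps_of_poly_pCons)
  have pl: "pa * ?l = fps_const a * fps_X"
  proof (rule fps_ext)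
    fix n
    have "pa * ?l = pa - fps_const a * (fps_X * pa)" unfolding l by (simp add: algebra_simps)
    then have "fps_nth (pa * ?l) n = fps_nth pa n - a * fps_nth (fps_X * pa) n" by simp
    also have "\<dots> = fps_nth (fps_const a * fps_X) n"
      by (cases n) (simp_all add: pa_def)
    finally show "fps_nth (pa * ?l) n = fps_nth (fps_const a * fps_X) n" .
  qed
  have sum: "Abs_fps (\<lambda>k. if k = 0 then 0 else (\<Sum>\<alpha>\<in>#add_mset a A. \<alpha> ^ k)) = pa + p"
    by (auto simp: fps_eq_iff pa_def p_def)
  have prod: "fps_of_poly (\<Prod>\<alpha>\<in>#add_mset a A. [:1, -\<alpha>:]) = ?l * ?D"
    by (simp add: fps_of_poly_mult del: mult_pCons_left)
  have "fps_X * fps_deriv (?l * ?D) = ?l * (fps_X * fps_deriv ?D) + (fps_X * fps_deriv ?l) * ?D"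
    by (simp add: algebra_simps)
  also have "fps_X * fps_deriv ?l = - (pa * ?l)" unfolding pl by (simp add: l)
  also have "fps_X * fps_deriv ?D = - (p * ?D)" using add by (simp add: p_def)
  finally show ?case unfolding sum prod by (simp add: algebra_simps)
qed

text \<open>The recurrence identifies \<open>S k\<close> with minus the k-th power sum of the
  inverse roots of the polynomial with coefficients \<open>a\<close>. There are at most
  \<open>m - 1\<close> of them, each of modulus at most \<open>r\<close>, so \<open>C\<close> drops
  out.\<close>

lemma char_sum_bound_from_recurrence:
  fixes a S :: "nat \<Rightarrow> complex"
  assumes a: "a 0 = 1" "\<And>n. n \<ge> m \<Longrightarrow> a n = 0"
    and rec: "\<And>n. of_nat n * a n = (\<Sum>k=1..n. S k * a (n - k))"
    and r: "r > 0" and bound: "\<And>k. k > 0 \<Longrightarrow> cmod (S k) \<le> C * r ^ k"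
  shows "cmod (S 1) \<le> (real m - 1) * r"
proof -
  have m: "m > 0" using a by (metis gr0I order_refl zero_neq_one)
  define P where "P = (\<Sum>i<m. monom (a i) i)"
  have cP: "coeff P i = a i" for i using a(2)[of i] by (auto simp: P_def coeff_sum)
  have P0: "coeff P 0 \<noteq> 0" by (simp add: cP a)
  have degP: "degree P \<le> m - 1"
    using m unfolding P_def by (intro degree_sum_le) (auto intro: order.trans[OF degree_monom_le])
  have Pn0: "P \<noteq> 0" using P0 by auto
  \<comment> \<open>The roots of the reflected polynomial are the inverse roots of \<open>P\<close>;
    reflection keeps the degree and makes the leading coefficient \<open>a 0 = 1\<close>.\<close>
  obtain A where A: "size A = degree (reflect_poly P)"
    "reflect_poly P = smult (lead_coeff (reflect_poly P)) (\<Prod>x\<in>#A. [:-x, 1:])"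
    using alg_closed_imp_factorization[of "reflect_poly P"] Pn0 by (metis reflect_poly_eq_0_iff)
  have "lead_coeff (reflect_poly P) = 1" using P0 by (simp add: coeff_reflect_poly cP a)
  with A(2) have "reflect_poly P = (\<Prod>x\<in>#A. [:-x, 1:])" by simp
  then have "P = reflect_poly (\<Prod>x\<in>#A. [:-x, 1:])" using P0 by (metis reflect_poly_reflect_poly)
  also have "\<dots> = (\<Prod>x\<in>#A. [:1, -x:])"
  proof (induction A)
    case (add x A)
    have "reflect_poly [:-x, 1:] = [:1, -x:]" by (simp add: reflect_poly_def)
    with add show ?case by (simp add: reflect_poly_mult del: mult_pCons_left)
  qed simp
  finally have P: "P = (\<Prod>x\<in>#A. [:1, -x:])" .
  define F where "F = Abs_fps (\<lambda>k. if k = 0 then 0 else S k)"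
  have "fps_X * fps_deriv (fps_of_poly P) = F * fps_of_poly P"
  proof (rule fps_ext)
    fix n
    have "fps_nth (F * fps_of_poly P) n = (\<Sum>k=0..n. (if k = 0 then 0 else S k) * a (n - k))"
      by (simp add: fps_mult_nth F_def cP)
    also have "\<dots> = (\<Sum>k=1..n. S k * a (n - k))"
      by (intro sum.mono_neutral_cong_right) auto
    also have "\<dots> = of_nat n * a n" by (rule rec[symmetric])
    finally show "fps_nth (fps_X * fps_deriv (fps_of_poly P)) n = fps_nth (F * fps_of_poly P) n"
      by (cases n) (simp_all add: cP)
  qed
  with newton_power_sums_fps[of A, folded P]
  have "(F + Abs_fps (\<lambda>k. if k = 0 then 0 else (\<Sum>\<alpha>\<in>#A. \<alpha> ^ k))) * fps_of_poly P = 0"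
    by (simp add: algebra_simps)
  moreover have "fps_of_poly P \<noteq> 0" using P0 by (metis fps_of_poly_nth fps_zero_nth)
  ultimately have eq: "F = - Abs_fps (\<lambda>k. if k = 0 then 0 else (\<Sum>\<alpha>\<in>#A. \<alpha> ^ k))"
    by (simp add: eq_neg_iff_add_eq_0)
  have S: "S k = - (\<Sum>\<alpha>\<in>#A. \<alpha> ^ k)" if "k > 0" for k
    using arg_cong[OF eq, of "\<lambda>F. fps_nth F k"] that by (simp add: F_def)
  have le: "cmod \<alpha> \<le> r" if "\<alpha> \<in># A" for \<alpha>
    using dominated_power_sums[OF r _ that, of C] bound S by (metis norm_minus_cancel)
  have "cmod (\<Sum>\<alpha>\<in>#A. \<alpha>) \<le> real (size A) * r"
    using le by (induction A) (auto intro!: order.trans[OF norm_triangle_ineq] simp: algebra_simps intro: add_mono)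
  also have "size A \<le> m - 1" using A(1) degP P0 by simp
  finally show ?thesis using S[of 1] r m by (simp add: mult_right_mono of_nat_diff)
qed

lemma card_roots_of_unity_le:
  assumes "d > 0"
  shows "card {\<omega>::'b::field. \<omega> ^ d = 1} \<le> d" "finite {\<omega>::'b. \<omega> ^ d = 1}"
proof -
  have d: "degree (monom 1 d + [:-1:] :: 'b poly) = d"
    using assms by (subst degree_add_eq_left) (auto simp: degree_monom_eq)
  then have n0: "monom 1 d + [:-1:] \<noteq> (0 :: 'b poly)" using assms by auto
  have eq: "{\<omega>::'b. \<omega> ^ d = 1} = {\<omega>. poly (monom 1 d + [:-1:]) \<omega> = 0}" by (auto simp: poly_monom)
  show "card {\<omega>::'b. \<omega> ^ d = 1} \<le> d" unfolding eq using card_poly_roots_bound[OF n0] d by simp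
  show "finite {\<omega>::'b. \<omega> ^ d = 1}" unfolding eq by (rule poly_roots_finite[OF n0])
qed

context kummer_sum
begin

lemma f_nonzero: "f \<noteq> 0" using f_monic by auto

text \<open>Let H be the common upper bound for the classes \<open>V \<omega>\<close>. The deficits
  H - |V \<omega>| are nonnegative and add up to at most d H - (Q - deg f), where the main terms
  cancel: upper bounds alone control the sum.\<close>

lemma char_sum_bound: "\<exists>C. \<forall>k>0. cmod (char_sum k) \<le> C * sqrt (real q) ^ k"
proof -
  obtain C where C: "C \<ge> 0" "\<And>Q s E \<omega>. Q = CHAR('b) ^ s \<Longrightarrow> Q > 1 \<Longrightarrow> \<theta> ^ Q = \<theta> \<Longrightarrow> d * E = Q - 1 \<Longrightarrow>
    real (card {x. x ^ Q = x \<and> poly f x \<noteq> 0 \<and> poly f x ^ E = \<omega>}) \<le> real Q / real d + C * sqrt (real Q)"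
    using stepanov_bound[OF char_prime f_eq g_\<theta> d_pos coprime_e_d e_pos] by blast
  define \<epsilon> where "\<epsilon> = (-1::'b) ^ degree f"
  have \<epsilon>: "\<epsilon> \<noteq> 0" by (simp add: \<epsilon>_def)
  have "cmod (char_sum k) \<le> (real d * C + real (degree f)) * sqrt (real q) ^ k" if k: "k > 0" for k
  proof -
    define Q where "Q = q ^ k"
    \<comment> \<open>The norm exponent; \<open>s * E\<close> plays for the extension the role of
      \<open>E\<close>, as \<open>d * (s * E) = Q - 1\<close>.\<close>
    define s where "s = (\<Sum>i<k. q ^ i)"
    have Q1: "Q > 1" unfolding Q_def using one_less_power[OF q_gt_1 k] .
    have "s * (q - 1) = Q - 1"
    proof -
      have "int s * (int q - 1) = int q ^ k - 1"
        unfolding s_def by (simp add: power_diff_1_eq mult.commute)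
      then have "int (s * (q - 1)) = int (Q - 1)"
        using q_gt_1 Q1 by (simp add: of_nat_diff Q_def)
      then show ?thesis by (simp only: of_nat_eq_iff)
    qed
    then have dE: "d * (s * E) = Q - 1" using d_E by (metis mult.left_commute)
    have \<theta>Q: "\<theta> ^ Q = \<theta>"
      unfolding Q_def using \<theta>_fixed
    proof (induction k)
      case (Suc k)
      then show ?case by (simp add: fixed_def mult.commute[of q] power_mult)
    qed simp
    define U where "U = {\<omega>::'b. \<omega> ^ d = 1}"
    define V where "V \<omega> = {x. x ^ Q = x \<and> poly f x \<noteq> 0 \<and> (\<epsilon> * poly f x) ^ (s * E) = \<omega>}" for \<omega>
    have V: "V \<omega> = {x. x ^ Q = x \<and> poly f x \<noteq> 0 \<and> poly f x ^ (s * E) = \<omega> / \<epsilon> ^ (s * E)}" for \<omega>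
      unfolding V_def using \<epsilon> by (auto simp: power_mult_distrib field_simps)
    have cV: "real (card (V \<omega>)) \<le> real Q / real d + C * sqrt (real Q)" for \<omega>
      unfolding V using C(2)[OF q_power[of k, folded Q_def] Q1 \<theta>Q dE] .
    have fixk: "fixed k = {x. x ^ Q = x}" by (simp add: fixed_def Q_def)
    have finV: "finite (V \<omega>)" for \<omega>
      using finite_fixed[OF k] unfolding V_def fixk by (rule rev_finite_subset) auto
    have inU: "(\<epsilon> * poly f x) ^ (s * E) \<in> U" if "x \<in> fixed k" "poly f x \<noteq> 0" for x
    proof -
      have "res f [:-x, 1:] = \<epsilon> * poly f x" by (simp add: res_linear_right f_monic \<epsilon>_def)
      have pf: "poly f x ^ Q = poly f x"
      proof -
        have "poly f (x ^ q ^ i) = poly f x ^ q ^ i" for i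
        proof (induction i)
          case (Suc i)
          have "poly f (x ^ q ^ Suc i) = poly f (x ^ q ^ i) ^ q"
            by (simp add: poly_frob[OF f_rational] mult.commute flip: power_mult)
          then show ?case using Suc by (simp add: mult.commute flip: power_mult)
        qed simp
        from this[of k] that(1) show ?thesis by (simp add: fixed_def Q_def)
      qed
      have "(-1::'b) ^ Q = -1"
        using freshmans_dream_diff[OF char_prime q_power, of 0 1 k] q_gt_1 by (simp add: power_0_left Q_def)
      then have "\<epsilon> ^ Q = \<epsilon>" unfolding \<epsilon>_def by (metis mult.commute power_mult)
      with pf have "(\<epsilon> * poly f x) ^ Q = \<epsilon> * poly f x" by (simp add: power_mult_distrib)
      then have "(\<epsilon> * poly f x) ^ (Q - 1) * (\<epsilon> * poly f x) = \<epsilon> * poly f x"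
        using Q1 power_minus_mult[of Q "\<epsilon> * poly f x"] by simp
      then have "(\<epsilon> * poly f x) ^ (Q - 1) = 1" using \<epsilon> that(2) by simp
      then show ?thesis unfolding U_def dE[symmetric] by (simp add: mult.commute flip: power_mult)
    qed
    have UV: "{x \<in> fixed k. poly f x \<noteq> 0} = (\<Union>\<omega>\<in>U. V \<omega>)"
      using inU by (auto simp: V_def fixk)
    have disj: "V \<omega> \<inter> V \<omega>' = {}" if "\<omega> \<noteq> \<omega>'" for \<omega> \<omega>' using that by (auto simp: V_def)
    have finU: "finite U" unfolding U_def by (rule card_roots_of_unity_le[OF d_pos])
    have s0: "s > 0" unfolding s_def using k q_gt_1 by (intro sum_pos) auto
    have "char_sum k = (\<Sum>x\<in>{x \<in> fixed k. poly f x \<noteq> 0}. \<psi> ((\<epsilon> * poly f x) ^ (s * E)))"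
    proof -
      have res: "res f (charpoly k x) = (\<epsilon> * poly f x) ^ s" for x
        unfolding res_charpoly[OF f_rational f_monic] \<epsilon>_def s_def ..
      have "char_sum k = (\<Sum>x\<in>{x \<in> fixed k. poly f x \<noteq> 0}. \<chi> (res f (charpoly k x)))"
        unfolding char_sum_def using finite_fixed[OF k] s0
        by (intro sum.mono_neutral_right) (auto simp: res \<chi>_0 power_0_left)
      also have "\<dots> = (\<Sum>x\<in>{x \<in> fixed k. poly f x \<noteq> 0}. \<psi> ((\<epsilon> * poly f x) ^ (s * E)))"
      proof (intro sum.cong refl)
        fix x assume x: "x \<in> {x \<in> fixed k. poly f x \<noteq> 0}"
        then have "res f (charpoly k x) \<in> fixed 1"
          using frob_res[OF f_rational rational_charpoly] by (simp add: fixed_def)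
        moreover have "res f (charpoly k x) \<noteq> 0" using x \<epsilon> unfolding res by simp
        ultimately show "\<chi> (res f (charpoly k x)) = \<psi> ((\<epsilon> * poly f x) ^ (s * E))"
          using \<chi>_\<psi> by (simp add: res power_mult)
      qed
      finally show ?thesis .
    qed
    also have "\<dots> = (\<Sum>\<omega>\<in>U. \<Sum>x\<in>V \<omega>. \<psi> ((\<epsilon> * poly f x) ^ (s * E)))"
      unfolding UV using finU finV disj by (intro sum.UNION_disjoint) auto
    also have "\<dots> = (\<Sum>\<omega>\<in>U. of_nat (card (V \<omega>)) * \<psi> \<omega>)"
    proof (intro sum.cong refl)
      fix \<omega>
      have "(\<Sum>x\<in>V \<omega>. \<psi> ((\<epsilon> * poly f x) ^ (s * E))) = (\<Sum>x\<in>V \<omega>. \<psi> \<omega>)"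
        by (intro sum.cong refl) (auto simp: V_def)
      then show "(\<Sum>x\<in>V \<omega>. \<psi> ((\<epsilon> * poly f x) ^ (s * E))) = of_nat (card (V \<omega>)) * \<psi> \<omega>" by simp
    qed
    finally have cs0: "char_sum k = (\<Sum>\<omega>\<in>U. of_nat (card (V \<omega>)) * \<psi> \<omega>)" .
    \<comment> \<open>The same number may be subtracted from every class size because the values of
      \<psi> sum to 0.\<close>
    have cs: "char_sum k = (\<Sum>\<omega>\<in>U. (of_nat (card (V \<omega>)) - of_real (real Q / real d + C * sqrt (real Q))) * \<psi> \<omega>)"
    proof -
      have "(\<Sum>\<omega>\<in>U. z * \<psi> \<omega>) = 0" for z using sum_\<psi> by (simp add: U_def flip: sum_distrib_left)
      then show ?thesis unfolding cs0 by (simp only: left_diff_distrib sum_subtractf diff_zero)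
    qed
    have "cmod (char_sum k) \<le> (\<Sum>\<omega>\<in>U. (real Q / real d + C * sqrt (real Q)) - real (card (V \<omega>)))"
      unfolding cs
    proof (rule order.trans[OF norm_sum], rule sum_mono)
      fix \<omega> assume \<omega>: "\<omega> \<in> U"
      have "cmod ((of_nat (card (V \<omega>)) - of_real (real Q / real d + C * sqrt (real Q))) * \<psi> \<omega>)
        = \<bar>real (card (V \<omega>)) - (real Q / real d + C * sqrt (real Q))\<bar> * cmod (\<psi> \<omega>)"
      proof -
        have "(of_nat (card (V \<omega>)) - of_real (real Q / real d + C * sqrt (real Q)) :: complex)
          = of_real (real (card (V \<omega>)) - (real Q / real d + C * sqrt (real Q)))" by simp
        then show ?thesis by (simp only: norm_mult norm_of_real)
      qed
      also have "\<dots> \<le> \<bar>real (card (V \<omega>)) - (real Q / real d + C * sqrt (real Q))\<bar> * 1"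
        using norm_\<psi>[of \<omega>] \<omega> by (intro mult_left_mono) (auto simp: U_def)
      also have "\<dots> = (real Q / real d + C * sqrt (real Q)) - real (card (V \<omega>))" using cV[of \<omega>] by simp
      finally show "cmod ((of_nat (card (V \<omega>)) - of_real (real Q / real d + C * sqrt (real Q))) * \<psi> \<omega>)
        \<le> (real Q / real d + C * sqrt (real Q)) - real (card (V \<omega>))" .
    qed
    also have "\<dots> = real (card U) * (real Q / real d + C * sqrt (real Q)) - real (\<Sum>\<omega>\<in>U. card (V \<omega>))"
      by (simp add: sum_subtractf)
    also have "\<dots> \<le> real d * (real Q / real d + C * sqrt (real Q)) - (real Q - real (degree f))"
    proof (intro diff_mono mult_right_mono)
      show "real (card U) \<le> real d" unfolding U_def using card_roots_of_unity_le(1)[OF d_pos] by simp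
      show "0 \<le> real Q / real d + C * sqrt (real Q)" using C(1) by simp
      have "(\<Sum>\<omega>\<in>U. card (V \<omega>)) = card {x \<in> fixed k. poly f x \<noteq> 0}"
        unfolding UV using finU finV disj by (intro card_UN_disjoint[symmetric]) auto
      moreover have "card (fixed k) \<le> card {x \<in> fixed k. poly f x \<noteq> 0} + card {x. poly f x = 0}"
        using finite_fixed[OF k] poly_roots_finite[OF f_nonzero]
        by (intro order.trans[OF card_mono card_Un_le]) auto
      moreover have "card {x. poly f x = 0} \<le> degree f" by (rule card_poly_roots_bound[OF f_nonzero])
      ultimately show "real Q - real (degree f) \<le> real (\<Sum>\<omega>\<in>U. card (V \<omega>))"
        using card_fixed[OF k] unfolding Q_def by linarith
    qed
    also have "\<dots> = real d * C * sqrt (real Q) + real (degree f)" using d_pos by (simp add: field_simps)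
    also have "\<dots> \<le> real d * C * sqrt (real Q) + real (degree f) * sqrt (real Q)"
      using Q1 by (intro add_left_mono) (simp add: mult_le_cancel_left1)
    also have "\<dots> = (real d * C + real (degree f)) * sqrt (real q) ^ k"
      by (simp add: Q_def real_sqrt_power algebra_simps)
    finally show ?thesis .
  qed
  then show ?thesis by blast
qed

text \<open>The case k = 1 of the power-sum argument, fed with the bounds for all extensions. The
  sign is the one relating the resultant with X - x to f(x).\<close>

theorem weil_bound:
  "cmod (\<Sum>x\<in>fixed 1. \<chi> ((-1) ^ degree f * poly f x)) \<le> (real (degree f) - 1) * sqrt (real q)"
proof -
  obtain C where C: "\<And>k. k > 0 \<Longrightarrow> cmod (char_sum k) \<le> C * sqrt (real q) ^ k"
    using char_sum_bound by blast
  have "cmod (char_sum 1) \<le> (real (degree f) - 1) * sqrt (real q)"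
    using q_gt_1
    by (intro char_sum_bound_from_recurrence[OF L_coeff_0 L_coeff_eq_0 L_recurrence _ C]) auto
  then show ?thesis
    by (simp add: char_sum_def res_charpoly[OF f_rational f_monic])
qed

end

section \<open>Counting power residues\<close>

lemma finite_field_cyclic:
  obtains \<gamma> :: "'a::{field,finite}"
  where "\<gamma> \<noteq> 0" "\<And>x. x \<noteq> 0 \<Longrightarrow> \<exists>i. x = \<gamma> ^ i" "\<And>x::'a. x \<noteq> 0 \<Longrightarrow> x ^ (CARD('a) - 1) = 1"
proof -
  let ?R = "ring_of_type_algebra :: 'a ring"
  have R: "field ?R" by (rule field_from_type_algebra)
  have G: "group (Multiplicative_Group.mult_of ?R)" by (rule field.field_mult_group[OF R])
  have car: "carrier (Multiplicative_Group.mult_of ?R) = UNIV - {0}" by (simp add: ring_of_type_algebra_def)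
  have pow: "x [^]\<^bsub>?R\<^esub> n = x ^ n" for x :: 'a and n :: nat
    by (induction n) (simp_all add: ring_of_type_algebra_def mult.commute)
  have fin: "finite (carrier ?R)" by (simp add: ring_of_type_algebra_def)
  obtain \<gamma> where \<gamma>: "\<gamma> \<in> carrier (Multiplicative_Group.mult_of ?R)" "carrier (Multiplicative_Group.mult_of ?R) = {\<gamma> [^]\<^bsub>?R\<^esub> i | i::nat. i \<in> UNIV}"
    using field.finite_field_mult_group_has_gen[OF R fin] by blast
  have "x ^ (CARD('a) - 1) = 1" if "x \<noteq> 0" for x :: 'a
  proof -
    have "x [^]\<^bsub>Multiplicative_Group.mult_of ?R\<^esub> Coset.order (Multiplicative_Group.mult_of ?R) = \<one>\<^bsub>Multiplicative_Group.mult_of ?R\<^esub>"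
      by (rule group.pow_order_eq_1[OF G]) (unfold car, use that in simp)
    then show ?thesis
      unfolding Multiplicative_Group.nat_pow_mult_of pow field.order_mult_of[OF R fin]
      by (simp add: Coset.order_def ring_of_type_algebra_def)
  qed
  moreover have "\<exists>i. x = \<gamma> ^ i" if "x \<noteq> 0" for x
    using that \<gamma>(2) unfolding car pow by blast
  ultimately show ?thesis using that \<gamma>(1) by (auto simp: ring_of_type_algebra_def)
qed

lemma finite_field_power_CARD: "(x :: 'a::{field,finite}) ^ CARD('a) = x"
proof (cases "x = 0")
  case False
  have "x ^ (CARD('a) - 1) = 1" using finite_field_cyclic False by metis
  moreover have "x ^ CARD('a) = x ^ (CARD('a) - 1) * x" by (rule power_minus_mult[symmetric]) simp
  ultimately show ?thesis using False by simp
qed simp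

lemma generator_power_eq_iff:
  fixes \<gamma> :: "'a::{field,finite}"
  assumes "\<gamma> \<noteq> 0" and gen: "\<And>x. x \<noteq> 0 \<Longrightarrow> \<exists>i. x = \<gamma> ^ i" and one: "\<gamma> ^ (CARD('a) - 1) = 1"
  shows "\<gamma> ^ i = \<gamma> ^ j \<longleftrightarrow> i mod (CARD('a) - 1) = j mod (CARD('a) - 1)"
proof -
  let ?n = "CARD('a) - 1"
  have "card {0, 1::'a} \<le> CARD('a)" by (intro card_mono) auto
  then have n: "?n > 0" by simp
  have m: "\<gamma> ^ i = \<gamma> ^ (i mod ?n)" for i
  proof -
    have "\<gamma> ^ i = \<gamma> ^ (?n * (i div ?n) + i mod ?n)" by simp
    also have "\<dots> = \<gamma> ^ (i mod ?n)" by (simp only: power_add power_mult one power_one mult_1)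
    finally show ?thesis .
  qed
  have "(\<lambda>i. \<gamma> ^ i) ` {..<?n} = UNIV - {0}"
  proof
    show "UNIV - {0} \<subseteq> (\<lambda>i. \<gamma> ^ i) ` {..<?n}"
    proof
      fix x :: 'a assume "x \<in> UNIV - {0}"
      then obtain i where "x = \<gamma> ^ i" using gen by auto
      then show "x \<in> (\<lambda>i. \<gamma> ^ i) ` {..<?n}" using m[of i] n by (intro image_eqI[of _ _ "i mod ?n"]) auto
    qed
  qed (use assms(1) in auto)
  then have inj: "inj_on (\<lambda>i. \<gamma> ^ i) {..<?n}"
    by (intro eq_card_imp_inj_on) (simp_all add: card_Diff_subset)
  show ?thesis
  proof
    assume "\<gamma> ^ i = \<gamma> ^ j"
    then have "\<gamma> ^ (i mod ?n) = \<gamma> ^ (j mod ?n)" using m by metis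
    then show "i mod ?n = j mod ?n" using inj_onD[OF inj] n by (meson lessThan_iff mod_less_divisor)
  qed (metis m)
qed

lemma root_of_unity_power_eq_iff:
  assumes "d > 0"
  shows "cis (2 * pi / real d) ^ i = cis (2 * pi / real d) ^ j \<longleftrightarrow> i mod d = j mod d"
proof -
  define \<zeta> where "\<zeta> = cis (2 * pi / real d)"
  have p: "\<zeta> ^ i = cis (2 * pi * real i / real d)" for i
    unfolding \<zeta>_def DeMoivre by (simp add: field_simps)
  have one: "\<zeta> ^ d = 1" using assms by (simp add: p)
  have m: "\<zeta> ^ i = \<zeta> ^ (i mod d)" for i
  proof -
    have "\<zeta> ^ i = \<zeta> ^ (d * (i div d) + i mod d)" by simp
    also have "\<dots> = \<zeta> ^ (i mod d)" by (simp only: power_add power_mult one power_one mult_1)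
    finally show ?thesis .
  qed
  have inj: "inj_on (\<lambda>i. \<zeta> ^ i) {..<d}"
    using bij_betw_roots_unity[OF assms] unfolding bij_betw_def p by simp
  have "\<zeta> ^ i = \<zeta> ^ j \<longleftrightarrow> i mod d = j mod d"
  proof
    assume "\<zeta> ^ i = \<zeta> ^ j"
    then have "\<zeta> ^ (i mod d) = \<zeta> ^ (j mod d)" using m by metis
    then show "i mod d = j mod d" using inj_onD[OF inj] assms by (meson lessThan_iff mod_less_divisor)
  qed (metis m)
  then show ?thesis unfolding \<zeta>_def .
qed

section \<open>Transfer to the algebraic closure\<close>

lemma map_poly_to_ac_mult: "map_poly to_ac (p * r) = map_poly to_ac p * map_poly to_ac r"
  by (rule poly_eqI) (simp add: coeff_map_poly coeff_mult to_ac_sum)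

lemma map_poly_to_ac_power: "map_poly to_ac (p ^ n) = map_poly to_ac p ^ n"
  by (induction n) (simp_all add: map_poly_to_ac_mult map_poly_1')

lemma poly_map_poly_to_ac: "poly (map_poly to_ac p) (to_ac x) = to_ac (poly p x)"
  by (induction p) (simp_all add: map_poly_pCons)

lemma degree_map_poly_to_ac: "degree (map_poly to_ac p) = degree p"
  by (rule degree_map_poly) simp

text \<open>Orthogonality of the characters \<open>z ^ j\<close>, \<open>j < d\<close>, detects
  \<open>E\<close>-th power equal to 1. The term j = 0 counts the nonzeros of \<open>f\<close>, and
  each of the other d - 1 is bounded by Weil.\<close>

theorem kummer_power_residue_count:
  fixes f g :: "'a::{field,finite} poly" and \<theta> a :: 'a
  assumes q: "CARD('a) = CHAR('a) ^ s"
    and f: "f = [:-\<theta>, 1:] ^ e * g" "poly g \<theta> \<noteq> 0" "lead_coeff f = 1"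
    and d: "d > 0" "e > 0" "coprime e d" "d * E = CARD('a) - 1" and a: "a \<noteq> 0"
  shows "real (CARD('a)) - real (degree f) - (real d - 1) * ((real (degree f) - 1) * sqrt (real CARD('a)))
    \<le> real d * real (card {x. poly f x \<noteq> 0 \<and> (a * poly f x) ^ E = 1})"
proof -
  define q where qC: "q = CARD('a)"
  let ?n = "q - 1"
  have "card {0, 1::'a} \<le> CARD('a)" by (intro card_mono) auto
  then have q1: "q > 1" by (simp add: qC)
  have s: "s > 0" using q1 assms(1) by (cases s) (auto simp: qC)
  have pr: "prime CHAR('a)"
    using prime_CHAR_semidom[where ?'a = 'a] finite_imp_CHAR_pos[where ?'a = 'a] by auto
  have E: "E > 0" using d(4) q1 by (cases E) (auto simp: qC)
  have fp: "frobenius_power (\<lambda>x::'a alg_closure. x ^ q) q s"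
    by unfold_locales (use pr assms(1) s in \<open>simp_all add: qC\<close>)
  obtain \<gamma> :: 'a where \<gamma>: "\<gamma> \<noteq> 0" "\<And>x. x \<noteq> 0 \<Longrightarrow> \<exists>i. x = \<gamma> ^ i" "\<And>x::'a. x \<noteq> 0 \<Longrightarrow> x ^ (CARD('a) - 1) = 1"
    using finite_field_cyclic by blast
  have \<gamma>_eq: "\<gamma> ^ i = \<gamma> ^ j \<longleftrightarrow> i mod (d * E) = j mod (d * E)" for i j
    using generator_power_eq_iff[of \<gamma> i j] \<gamma>(1,2) \<gamma>(3)[OF \<gamma>(1)] unfolding d(4) by blast
  define \<zeta> where "\<zeta> = cis (2 * pi / real d)"
  have \<zeta>_eq: "\<zeta> ^ i = \<zeta> ^ j \<longleftrightarrow> i mod d = j mod d" for i j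
    unfolding \<zeta>_def by (rule root_of_unity_power_eq_iff[OF d(1)])
  have \<zeta>_norm: "cmod (\<zeta> ^ i) = 1" for i by (simp add: \<zeta>_def norm_power)
  \<comment> \<open>A discrete logarithm, determined only modulo \<open>d * E\<close>; this is
    enough, since \<zeta> depends on the exponent modulo \<open>d\<close>.\<close>
  define ind where "ind x = (SOME i. x = \<gamma> ^ i)" for x
  have ind: "x = \<gamma> ^ ind x" if "x \<noteq> 0" for x
    unfolding ind_def using someI_ex[OF \<gamma>(2)[OF that]] .
  define z where "z x = \<zeta> ^ ind x" for x
  have zi: "z (\<gamma> ^ i) = \<zeta> ^ i" for i
  proof -
    have "\<gamma> ^ i = \<gamma> ^ ind (\<gamma> ^ i)" using ind[of "\<gamma> ^ i"] \<gamma>(1) by simp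
    then have "i mod (d * E) mod d = ind (\<gamma> ^ i) mod (d * E) mod d" unfolding \<gamma>_eq by simp
    then have "i mod d = ind (\<gamma> ^ i) mod d" by (simp add: mod_mod_cancel)
    then show ?thesis unfolding z_def \<zeta>_eq by simp
  qed
  have z_mult: "z (x * y) = z x * z y" if xy: "x \<noteq> 0" "y \<noteq> 0" for x y
  proof -
    obtain i j where "x = \<gamma> ^ i" "y = \<gamma> ^ j" using \<gamma>(2) xy by metis
    then show ?thesis by (simp add: zi flip: power_add)
  qed
  have z_1_iff: "z x = 1 \<longleftrightarrow> x ^ E = 1" if x: "x \<noteq> 0" for x
  proof -
    obtain i where i: "x = \<gamma> ^ i" using \<gamma>(2) x by metis
    have "z x = 1 \<longleftrightarrow> d dvd i" using \<zeta>_eq[of i 0] by (simp add: i zi mod_eq_0_iff_dvd)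
    also have "\<dots> \<longleftrightarrow> d * E dvd i * E" using E by simp
    also have "\<dots> \<longleftrightarrow> x ^ E = 1" using \<gamma>_eq[of "i * E" 0] by (simp add: i mod_eq_0_iff_dvd flip: power_mult)
    finally show ?thesis .
  qed
  have z_pow_d: "z x ^ d = 1" for x
    using \<zeta>_eq[of "ind x * d" 0] by (simp add: z_def flip: power_mult)
  have pq: "x ^ q = x" for x :: 'a unfolding qC by (rule finite_field_power_CARD)
  let ?fixed = "frobenius_power.fixed q :: nat \<Rightarrow> 'a alg_closure set"
  have fix_eq: "?fixed 1 = range (to_ac :: 'a \<Rightarrow> 'a alg_closure)"
  proof (rule card_subset_eq[symmetric])
    show "range (to_ac :: 'a \<Rightarrow> _) \<subseteq> ?fixed 1"
      by (auto simp: frobenius_power.fixed_def[OF fp] pq simp flip: to_ac_power)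
    show "card (range (to_ac :: 'a \<Rightarrow> _)) = card (?fixed 1)"
      using frobenius_power.card_fixed[OF fp, of 1] by (simp add: card_image inj_to_ac qC[symmetric])
  qed (rule frobenius_power.finite_fixed[OF fp], simp)
  define F G where "F = map_poly to_ac f" and "G = map_poly to_ac g"
  \<comment> \<open>Weil's bound carries this sign; being its own inverse, it moves into the
    constant factor \<open>z (a * \<epsilon>)\<close> of modulus 1.\<close>
  define \<epsilon> where "\<epsilon> = (-1::'a) ^ degree f"
  have \<epsilon>: "\<epsilon> \<noteq> 0" "\<epsilon> * \<epsilon> = 1" by (auto simp: \<epsilon>_def simp flip: power_add power_mult_distrib)
  have weil: "cmod (\<Sum>x | poly f x \<noteq> 0. z (\<epsilon> * poly f x) ^ j) \<le> (real (degree f) - 1) * sqrt (real q)"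
    if j: "0 < j" "j < d" for j
  proof -
    define \<chi> where "\<chi> y = (if y = 0 then 0 else z (of_ac y) ^ j)" for y
    \<comment> \<open>The exponent chosen is unique modulo \<open>d\<close>, so \<psi> is a
      well-defined character of the \<open>d\<close>-th roots of unity, all of which are powers of
      \<open>to_ac \<gamma> ^ E\<close>.\<close>
    define \<psi> where "\<psi> \<omega> = \<zeta> ^ (j * (SOME i. \<omega> = to_ac \<gamma> ^ (E * i)))" for \<omega>
    have \<psi>: "\<psi> (to_ac \<gamma> ^ (E * i)) = \<zeta> ^ (j * i)" for i
    proof -
      have "\<exists>k. to_ac \<gamma> ^ (E * i) = to_ac \<gamma> ^ (E * k)" by blast
      from someI_ex[OF this] have "\<gamma> ^ (E * i) = \<gamma> ^ (E * (SOME k. to_ac \<gamma> ^ (E * i) = to_ac \<gamma> ^ (E * k)))"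
        by (simp only: to_ac_power[symmetric] to_ac_eq_iff)
      then have "i mod d = (SOME k. to_ac \<gamma> ^ (E * i) = to_ac \<gamma> ^ (E * k)) mod d"
        unfolding \<gamma>_eq mult.commute[of d E] mult_mod_right[symmetric] using E by simp
      then show ?thesis unfolding \<psi>_def mult.commute[of j] power_mult by (metis \<zeta>_eq)
    qed
    have roots: "{\<omega>::'a alg_closure. \<omega> ^ d = 1} = (\<lambda>i. to_ac \<gamma> ^ (E * i)) ` {..<d}"
      and inj: "inj_on (\<lambda>i. to_ac \<gamma> ^ (E * i)) {..<d}"
    proof -
      show inj: "inj_on (\<lambda>i. to_ac \<gamma> ^ (E * i)) {..<d}"
      proof (rule inj_onI)
        fix i k assume ik: "i \<in> {..<d}" "k \<in> {..<d}" "to_ac \<gamma> ^ (E * i) = to_ac \<gamma> ^ (E * k)"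
        then have "\<gamma> ^ (E * i) = \<gamma> ^ (E * k)" by (simp only: to_ac_power[symmetric] to_ac_eq_iff)
        then have "i mod d = k mod d"
          unfolding \<gamma>_eq mult.commute[of d E] mult_mod_right[symmetric] using E by simp
        with ik show "i = k" by simp
      qed
      have sub: "(\<lambda>i. to_ac \<gamma> ^ (E * i)) ` {..<d} \<subseteq> {\<omega>. \<omega> ^ d = 1}"
      proof clarify
        fix i
        have "\<gamma> ^ (E * i * d) = \<gamma> ^ 0" unfolding \<gamma>_eq by (simp add: mult.commute mult.left_commute)
        then show "(to_ac \<gamma> ^ (E * i)) ^ d = 1" by (metis power_0 power_mult to_ac_1 to_ac_power)
      qed
      show "{\<omega>::'a alg_closure. \<omega> ^ d = 1} = (\<lambda>i. to_ac \<gamma> ^ (E * i)) ` {..<d}"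
        using card_image[OF inj] card_roots_of_unity_le[OF d(1), where ?'b = "'a alg_closure"]
        by (intro card_seteq[OF _ sub, symmetric]) auto
    qed
    have "kummer_sum (\<lambda>x. x ^ q) q s F G (to_ac \<theta>) e d E \<chi> \<psi>"
    proof (intro kummer_sum.intro[OF fp] kummer_sum_axioms.intro)
      have "map_poly to_ac [:-\<theta>, 1:] = [:-to_ac \<theta>, 1:]" by (simp add: map_poly_pCons)
      then show "F = [:-to_ac \<theta>, 1:] ^ e * G"
        unfolding F_def G_def f(1) by (simp only: map_poly_to_ac_mult map_poly_to_ac_power)
      show "poly G (to_ac \<theta>) \<noteq> 0" using f(2) by (simp add: G_def poly_map_poly_to_ac)
      show "to_ac \<theta> \<in> ?fixed 1" unfolding fix_eq by simp
      show "frobenius_power.rational q F" unfolding frobenius_power.rational_def[OF fp]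
        by (rule poly_eqI) (simp add: F_def coeff_map_poly frobenius_power.coeff_frob_poly[OF fp] pq flip: to_ac_power)
      show "lead_coeff F = 1" using f(3) unfolding F_def by (simp add: degree_map_poly_to_ac coeff_map_poly)
      show "e > 0" "d > 0" "coprime e d" "d * E = q - 1" using d by (simp_all add: qC)
      show "\<chi> 0 = 0" by (simp add: \<chi>_def)
      have "of_ac (1 :: 'a alg_closure) = 1" by (metis of_ac_to_ac to_ac_1)
      then show "\<chi> 1 = 1" using zi[of 0] by (simp add: \<chi>_def)
      show "\<chi> (x * y) = \<chi> x * \<chi> y" if xy: "x \<in> ?fixed 1" "y \<in> ?fixed 1" for x y
      proof -
        obtain x' y' where "x = to_ac x'" "y = to_ac y'" using xy unfolding fix_eq by auto
        then show ?thesis by (simp add: \<chi>_def z_mult power_mult_distrib flip: to_ac_mult)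
      qed
      show "\<chi> x = \<psi> (x ^ E)" if x: "x \<in> ?fixed 1" "x \<noteq> 0" for x
      proof -
        obtain x' where x': "x = to_ac x'" using x unfolding fix_eq by auto
        obtain i where i: "x' = \<gamma> ^ i" using \<gamma>(2)[of x'] x x' by auto
        have "x ^ E = to_ac \<gamma> ^ (E * i)" by (simp add: x' i mult.commute flip: power_mult)
        moreover have "\<chi> x = z x' ^ j" using x(2) by (simp add: \<chi>_def x')
        ultimately show ?thesis using \<psi>[of i] by (simp add: i zi mult.commute flip: power_mult)
      qed
      show "cmod (\<psi> \<omega>) \<le> 1" for \<omega> by (simp add: \<psi>_def \<zeta>_norm)
      have \<zeta>j: "\<zeta> ^ j \<noteq> 1" using \<zeta>_eq[of j 0] j by simp
      have "(\<Sum>\<omega> | \<omega> ^ d = 1. \<psi> \<omega>) = (\<Sum>i<d. (\<zeta> ^ j) ^ i)"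
        unfolding roots using inj by (simp add: sum.reindex \<psi> flip: power_mult)
      also have "\<dots> = ((\<zeta> ^ j) ^ d - 1) / (\<zeta> ^ j - 1)" using \<zeta>j by (rule geometric_sum)
      also have "(\<zeta> ^ j) ^ d = 1" using \<zeta>_eq[of "j * d" 0] by (simp flip: power_mult)
      finally show "(\<Sum>\<omega> | \<omega> ^ d = 1. \<psi> \<omega>) = 0" by simp
      show "\<exists>u\<in>?fixed 1. u \<noteq> 0 \<and> \<chi> (u ^ e) \<noteq> 1"
      proof (intro bexI conjI)
        have "\<chi> (to_ac \<gamma> ^ e) = \<zeta> ^ (e * j)" using \<gamma>(1) by (simp add: \<chi>_def zi power_mult flip: to_ac_power)
        moreover have "\<not> d dvd e * j" using d(3) j
          by (metis coprime_commute coprime_dvd_mult_right_iff nat_dvd_not_less)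
        ultimately show "\<chi> (to_ac \<gamma> ^ e) \<noteq> 1" using \<zeta>_eq[of "e * j" 0] by (simp add: mod_eq_0_iff_dvd)
      qed (unfold fix_eq, use \<gamma> in auto)
    qed
    note weil_bound = kummer_sum.weil_bound[OF this]
    have "(\<Sum>x\<in>?fixed 1. \<chi> ((-1) ^ degree F * poly F x)) = (\<Sum>x\<in>UNIV. \<chi> (to_ac (\<epsilon> * poly f x)))"
      unfolding fix_eq sum.reindex[OF inj_to_ac] comp_def
      by (simp add: F_def degree_map_poly_to_ac poly_map_poly_to_ac \<epsilon>_def)
    also have "\<dots> = (\<Sum>x | poly f x \<noteq> 0. z (\<epsilon> * poly f x) ^ j)"
      using \<epsilon> by (intro sum.mono_neutral_cong_right) (auto simp: \<chi>_def simp flip: to_ac_mult)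
    finally show ?thesis using weil_bound by (simp add: F_def degree_map_poly_to_ac)
  qed
  define N where "N = card {x. poly f x \<noteq> 0 \<and> (a * poly f x) ^ E = 1}"
  define V where "V = {x. poly f x \<noteq> 0}"
  have f0: "f \<noteq> 0" using f(3) by auto
  have gs: "(\<Sum>j<d. z y ^ j) = (if y ^ E = 1 then of_nat d else 0)" if y: "y \<noteq> 0" for y
    using z_1_iff[OF y] z_pow_d[of y] by (auto simp: geometric_sum)
  have "(\<Sum>j<d. z (a * \<epsilon>) ^ j * (\<Sum>x\<in>V. z (\<epsilon> * poly f x) ^ j)) = (\<Sum>j<d. \<Sum>x\<in>V. z (a * poly f x) ^ j)"
  proof (unfold sum_distrib_left, intro sum.cong refl)
    fix j x assume "x \<in> V"
    then have "z (a * \<epsilon> * (\<epsilon> * poly f x)) = z (a * \<epsilon>) * z (\<epsilon> * poly f x)"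
      using a \<epsilon> by (intro z_mult) (auto simp: V_def)
    moreover have "a * \<epsilon> * (\<epsilon> * poly f x) = a * poly f x" using \<epsilon>(2) by (metis mult.assoc mult_1)
    ultimately show "z (a * \<epsilon>) ^ j * z (\<epsilon> * poly f x) ^ j = z (a * poly f x) ^ j"
      by (simp add: power_mult_distrib)
  qed
  also have "\<dots> = (\<Sum>x\<in>V. \<Sum>j<d. z (a * poly f x) ^ j)" by (rule sum.swap)
  also have "\<dots> = (\<Sum>x\<in>V. if (a * poly f x) ^ E = 1 then of_nat d else 0)"
    using a by (intro sum.cong refl gs) (auto simp: V_def)
  also have "\<dots> = of_nat d * of_nat N"
    by (simp add: sum.If_cases N_def V_def Collect_conj_eq[symmetric] Int_def)
  finally have total: "of_nat d * of_nat N = (\<Sum>j<d. z (a * \<epsilon>) ^ j * (\<Sum>x\<in>V. z (\<epsilon> * poly f x) ^ j))" ..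
  define D where "D = (\<Sum>j\<in>{..<d} - {0}. z (a * \<epsilon>) ^ j * (\<Sum>x\<in>V. z (\<epsilon> * poly f x) ^ j))"
  have "of_nat d * of_nat N = of_nat (card V) + D"
    unfolding total D_def using d(1) by (subst sum.remove[of _ 0]) auto
  then have "(of_real (real d * real N - real (card V)) :: complex) = D" by simp
  then have "\<bar>real d * real N - real (card V)\<bar> = cmod D" by (metis norm_of_real)
  also have "\<dots> \<le> (\<Sum>j\<in>{..<d} - {0}. (real (degree f) - 1) * sqrt (real q))"
    unfolding D_def
  proof (rule order.trans[OF norm_sum], rule sum_mono)
    fix j assume "j \<in> {..<d} - {0}"
    then have "cmod (\<Sum>x\<in>V. z (\<epsilon> * poly f x) ^ j) \<le> (real (degree f) - 1) * sqrt (real q)"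
      using weil[of j] unfolding V_def by simp
    then show "cmod (z (a * \<epsilon>) ^ j * (\<Sum>x\<in>V. z (\<epsilon> * poly f x) ^ j)) \<le> (real (degree f) - 1) * sqrt (real q)"
      using \<zeta>_norm[of "ind (a * \<epsilon>) * j"] unfolding norm_mult z_def[of "a * \<epsilon>"] power_mult by simp
  qed
  also have "\<dots> = (real d - 1) * ((real (degree f) - 1) * sqrt (real q))"
    using d(1) by (simp add: of_nat_diff)
  finally have "real (card V) - (real d - 1) * ((real (degree f) - 1) * sqrt (real q)) \<le> real d * real N" by linarith
  moreover have "real q - real (degree f) \<le> real (card V)"
  proof -
    have "q = card (V \<union> {x. poly f x = 0})" unfolding qC V_def by (intro arg_cong[of _ _ card]) auto
    also have "\<dots> \<le> card V + card {x. poly f x = 0}" by (rule card_Un_le)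
    also have "\<dots> \<le> card V + degree f" using card_poly_roots_bound[OF f0] by simp
    finally show ?thesis by linarith
  qed
  ultimately show ?thesis unfolding N_def qC by linarith
qed

section \<open>Planar monomials\<close>

lemma of_nat_CHAR_2:
  assumes "CHAR('a::ring_1) = 2"
  shows "(of_nat n :: 'a) = (if even n then 0 else 1)"
proof -
  have two: "(of_nat 2 :: 'a) = 0" using of_nat_CHAR[where ?'a = 'a] assms by simp
  have "(of_nat n :: 'a) = of_nat 2 * of_nat (n div 2) + of_nat (n mod 2)"
    by (metis mult_div_mod_eq of_nat_add of_nat_mult)
  then show ?thesis unfolding two by (cases "even n") (simp_all add: odd_iff_mod_2_eq_one)
qed

lemma add_self_CHAR_2: "CHAR('a::ring_1) = 2 \<Longrightarrow> x + x = (0 :: 'a)"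
  by (metis add.right_inverse uminus_CHAR_2)

text \<open>The Cauchy--Mirimanoff polynomial \<open>(X + 1)\<^sup>t + X\<^sup>t + 1\<close>: its root \<open>1\<close> is simple for odd \<open>t\<close>,
  which is what makes the multiplicity \<open>2\<^sup>k\<close> prime to the odd number \<open>d\<close> in general.\<close>

definition mirimanoff :: "nat \<Rightarrow> 'a::comm_ring_1 poly" where
  "mirimanoff t = [:1, 1:] ^ t + monom 1 t + 1"

lemma poly_mirimanoff: "poly (mirimanoff t) x = (x + 1) ^ t + x ^ t + 1"
  by (simp add: mirimanoff_def poly_monom add.commute)

text \<open>The derivative for odd \<open>s\<close> takes the value s = 1 at 1, so that root is
  simple; 0 is a root too. Frobenius makes the polynomial for 2^k s the 2^k-th power of that for s;
  one factor X is split off and the rest goes into \<open>g\<close>.\<close>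

lemma mirimanoff_factorization:
  assumes char: "CHAR('a::field) = 2" and s: "odd s" "s > 1"
  obtains g :: "'a::field poly" where "poly g 1 \<noteq> 0"
    "mirimanoff (2 ^ k * s) = [:0, 1:] * ([:-1, 1:] ^ (2 ^ k) * g)"
proof -
  let ?M = "mirimanoff s :: 'a poly"
  have two: "(1 + 1 :: 'a) = 0" using of_nat_CHAR_2[OF char, of 2] by simp
  have "poly ?M 1 = 0" using s two by (simp only: poly_mirimanoff) (simp add: power_0_left)
  then obtain h where h: "?M = [:-1, 1:] * h" using poly_eq_0_iff_dvd by (metis dvdE)
  have "poly (pderiv ?M) 1 = of_nat s * (1 + 1) ^ (s - 1) + of_nat s"
    by (simp add: mirimanoff_def pderiv_add pderiv_power pderiv_pCons pderiv_monom poly_monom poly_power)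
  also have "\<dots> = 1" unfolding two using s of_nat_CHAR_2[OF char, of s] by (simp add: power_0_left)
  also have "poly (pderiv ?M) 1 = poly h 1" unfolding h pderiv_mult by (simp add: pderiv_pCons)
  finally have h1: "poly h 1 = 1" .
  have "poly ?M 0 = 0" using s two by (simp add: poly_mirimanoff power_0_left)
  then have "poly h 0 = 0" unfolding h by simp
  then obtain u where u: "h = [:0, 1:] * u" using poly_eq_0_iff_dvd[of h 0] by (metis dvdE minus_zero)
  let ?e = "2 ^ k :: nat"
  define g where "g = [:0, 1:] ^ (?e - 1) * u ^ ?e"
  have pc: "prime CHAR('a poly)" "?e = CHAR('a poly) ^ k" using char by simp_all
  have "mirimanoff (?e * s) = ([:1, 1:] ^ s) ^ ?e + monom 1 s ^ ?e + (1::'a poly) ^ ?e"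
    by (simp add: mirimanoff_def monom_power mult.commute flip: power_mult)
  also have "\<dots> = ?M ^ ?e"
    unfolding mirimanoff_def by (simp only: freshmans_dream'[OF pc])
  also have "\<dots> = [:-1, 1:] ^ ?e * ([:0, 1:] ^ ?e * u ^ ?e)"
    unfolding h u by (simp only: power_mult_distrib)
  also have "[:0, 1:] ^ ?e = [:0, 1:] * ([:0, 1:] ^ (?e - 1) :: 'a poly)"
    by (simp only: power_Suc[symmetric]) simp
  finally have "mirimanoff (?e * s) = [:0, 1:] * ([:-1, 1:] ^ ?e * g)"
    unfolding g_def by (simp only: mult_ac)
  moreover have "poly g 1 \<noteq> 0" using h1 unfolding g_def u by (simp add: poly_power)
  ultimately show ?thesis using that by blast
qed

lemma coeff_mirimanoff:
  "coeff (mirimanoff t) i = of_nat ((t choose i) + (if i = t then 1 else 0) + (if i = 0 then 1 else 0))"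
  by (simp add: mirimanoff_def coeff_linear_poly_power')

text \<open>The two terms X^t cancel in characteristic 2. All coefficients are images of integers,
  so a nonzero leading one is 1.\<close>

lemma degree_mirimanoff:
  assumes "CHAR('a::field) = 2" "t > 0" "(mirimanoff t :: 'a::field poly) \<noteq> 0"
  shows "degree (mirimanoff t :: 'a::field poly) < t" "lead_coeff (mirimanoff t :: 'a::field poly) = 1"
proof -
  have "degree (mirimanoff t :: 'a poly) \<le> t"
    using assms(2) by (intro degree_le) (auto simp: coeff_mirimanoff binomial_eq_0)
  moreover have "coeff (mirimanoff t :: 'a poly) t = 0"
    unfolding coeff_mirimanoff using assms(2) of_nat_CHAR_2[OF assms(1), of 2] by simp
  ultimately show "degree (mirimanoff t :: 'a poly) < t"
    using assms(3) by (metis leading_coeff_0_iff le_neq_implies_less)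
  have "lead_coeff (mirimanoff t :: 'a poly) \<noteq> 0" using assms(3) by simp
  then show "lead_coeff (mirimanoff t :: 'a poly) = 1"
    unfolding coeff_mirimanoff of_nat_CHAR_2[OF assms(1)] by (metis (full_types))
qed

text \<open>Planarity at \<open>b = x w\<close>, tested on the pair \<open>0, w\<close>.\<close>

lemma planar_monomial_avoids:
  fixes a x y :: "'a::{field,finite}"
  assumes char: "CHAR('a) = 2" and pl: "planar (\<lambda>c::'a. a * c ^ t)" and t: "t > 2"
    and x: "x \<noteq> 0" and xy: "x * y = (x + 1) ^ t + x ^ t + 1"
  shows "a * y * w ^ (t - 2) \<noteq> 1"
proof (cases "w = 0")
  case True
  then have w0: "w ^ (t - 2) = 0" using t by (simp add: zero_power)
  show ?thesis unfolding w0 by simp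
next
  case False
  show ?thesis
  proof
    assume eq: "a * y * w ^ (t - 2) = 1"
    note two = add_self_CHAR_2[OF char]
    define b where "b = x * w"
    have b: "b \<noteq> 0" using x False by (simp add: b_def)
    have "t = t - 2 + 2" using t by simp
    then have "w ^ t = w ^ (t - 2) * w ^ 2" by (metis power_add)
    then have "a * w ^ t * (x * y) = (a * y * w ^ (t - 2)) * (b * w)"
      by (simp add: b_def power2_eq_square)
    then have "b * w = a * w ^ t * ((x + 1) ^ t + x ^ t + 1)" unfolding eq xy by simp
    also have "\<dots> = a * (((x + 1) * w) ^ t + b ^ t + w ^ t)"
      by (simp only: b_def power_mult_distrib) (simp add: algebra_simps)
    also have "(x + 1) * w = w + b" by (simp add: b_def algebra_simps)
    \<comment> \<open>In characteristic 2 this is precisely the collision of \<open>?F\<close> at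
      \<open>w\<close> and 0.\<close>
    finally have bw: "b * w = a * (w + b) ^ t + a * b ^ t + a * w ^ t" by (simp add: algebra_simps)
    let ?F = "\<lambda>c. a * (c + b) ^ t + a * c ^ t + b * c"
    have "?F w = a * b ^ t + ((a * (w + b) ^ t + a * (w + b) ^ t) + (a * w ^ t + a * w ^ t))"
      unfolding bw by (simp only: ac_simps)
    also have "\<dots> = ?F 0" using t by (simp add: two power_0_left)
    finally have "?F w = ?F 0" .
    moreover have "bij ?F" using pl[unfolded planar_def, rule_format, OF b] .
    ultimately have "w = 0" using injD[OF bij_is_inj, of ?F w 0] by blast
    then show False using False by contradiction
  qed
qed

text \<open>The 2^k-th power is additive, so the map to be inverted is a constant plus
  \<open>b * c\<close>.\<close>

lemma planar_power_2:
  fixes a :: "'a::{field,finite}"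
  assumes char: "CHAR('a) = 2"
  shows "planar (\<lambda>c::'a. a * c ^ 2 ^ k)"
  unfolding planar_def
proof (intro allI impI)
  fix b :: 'a assume b: "b \<noteq> 0"
  note two = add_self_CHAR_2[OF char]
  have "a * (c + b) ^ 2 ^ k + a * c ^ 2 ^ k + b * c = a * b ^ 2 ^ k + b * c" for c
  proof -
    have "(c + b) ^ 2 ^ k = c ^ 2 ^ k + b ^ 2 ^ k"
      by (rule freshmans_dream'[where n = k]) (simp_all add: char)
    then have "a * (c + b) ^ 2 ^ k + a * c ^ 2 ^ k + b * c = (a * c ^ 2 ^ k + a * c ^ 2 ^ k) + (a * b ^ 2 ^ k + b * c)"
      by (simp only: distrib_left ac_simps)
    then show ?thesis by (simp add: two)
  qed
  then have "inj (\<lambda>c. a * (c + b) ^ 2 ^ k + a * c ^ 2 ^ k + b * c)"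
    using b by (auto simp: inj_def)
  then show "bij (\<lambda>c. a * (c + b) ^ 2 ^ k + a * c ^ 2 ^ k + b * c)"
    by (simp add: bij_def finite_UNIV_inj_surj)
qed



text \<open>In a cyclic group, \<open>v ^ E = 1\<close> makes \<open>v\<close> a power with exponent
  the gcd; Bezout writes the gcd as a multiple of \<open>j\<close> modulo the group order, so
  \<open>v\<close> is a \<open>j\<close>-th power and \<open>w\<close> is the inverse of the
  root.\<close>

lemma power_residue:
  fixes v :: "'a::{field,finite}"
  assumes v: "v \<noteq> 0" "v ^ E = 1" and j: "j > 0" and E: "gcd j (CARD('a) - 1) * E = CARD('a) - 1"
  obtains w where "v * w ^ j = 1"
proof -
  let ?n = "CARD('a) - 1" and ?d = "gcd j (CARD('a) - 1)"
  obtain \<gamma> :: 'a where \<gamma>: "\<gamma> \<noteq> 0" "\<And>x. x \<noteq> 0 \<Longrightarrow> \<exists>i. x = \<gamma> ^ i" "\<And>x::'a. x \<noteq> 0 \<Longrightarrow> x ^ ?n = 1"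
    using finite_field_cyclic by blast
  have "card {0, 1::'a} \<le> CARD('a)" by (intro card_mono) auto
  then have n: "?n > 0" by simp
  then have E0: "E > 0" using E by (cases E) auto
  obtain i where i: "v = \<gamma> ^ i" using \<gamma>(2) v(1) by blast
  have "\<gamma> ^ (i * E) = \<gamma> ^ 0" using v(2) by (simp add: i power_mult)
  then have "(i * E) mod ?n = 0 mod ?n" using generator_power_eq_iff[of \<gamma> "i * E" 0] \<gamma> by blast
  then have "?d * E dvd i * E" unfolding E by (simp only: mod_0 mod_eq_0_iff_dvd)
  then obtain l where l: "i = ?d * l" using E0 by (auto simp: dvd_def)
  obtain x y where xy: "j * x = ?n * y + ?d" using bezout_nat[of j ?n] j by auto
  define u where "u = \<gamma> ^ (x * l)"
  have "u ^ j = \<gamma> ^ (j * x * l)" by (simp add: u_def mult_ac flip: power_mult)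
  also have "\<dots> = (\<gamma> ^ ?n) ^ (y * l) * \<gamma> ^ i"
    unfolding xy l by (simp only: add_mult_distrib power_add power_mult mult.assoc)
  also have "\<dots> = v" using \<gamma>(3)[OF \<gamma>(1)] by (simp add: i)
  finally have "v * inverse u ^ j = 1" using v(1) by (simp add: power_inverse)
  then show ?thesis by (rule that)
qed

theorem theorem1:
  fixes a :: "'a::{field,finite}" and r t :: nat
  assumes "r > 0"
    and "CARD('a) = 2 ^ r"
    and "t > 0"
    and "t ^ 4 \<le> 2 ^ r"
    and "a \<noteq> 0"
  shows "planar (\<lambda>c::'a. a * c ^ t) \<longleftrightarrow> (\<exists>k::nat. t = 2 ^ k)"
proof -
  let ?q = "CARD('a)"
  have char: "CHAR('a) = 2"
  proof -
    obtain \<gamma> :: 'a where "\<And>x::'a. x \<noteq> 0 \<Longrightarrow> x ^ (?q - 1) = 1" using finite_field_cyclic by metis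
    from this[of "-1"] have "(-1 :: 'a) ^ (?q - 1) = 1" by simp
    moreover have "odd (?q - 1)" using assms(1,2) by simp
    ultimately have "(-1 :: 'a) = 1" by simp
    then have "of_nat 2 = (0 :: 'a)" by (metis add.right_inverse of_nat_1 of_nat_add one_add_one)
    then have "CHAR('a) dvd 2" by (simp only: of_nat_eq_0_iff_char_dvd)
    then show ?thesis by (metis CHAR_not_1' One_nat_def prime_nat_iff two_is_prime_nat)
  qed
  show ?thesis
  proof
    assume "\<exists>k::nat. t = 2 ^ k"
    then show "planar (\<lambda>c::'a. a * c ^ t)" using planar_power_2[OF char] by blast
  next
    assume pl: "planar (\<lambda>c::'a. a * c ^ t)"
    show "\<exists>k::nat. t = 2 ^ k"
    proof (rule ccontr)
      assume no: "\<nexists>k::nat. t = 2 ^ k"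
      obtain s where s: "t = 2 ^ multiplicity 2 t * s" "\<not> 2 dvd s"
        using multiplicity_decompose'[of t 2] assms(3) by auto
      define k where "k = multiplicity 2 t"
      note s = s[folded k_def]
      have s1: "s > 1" using s no by (cases s; cases "s = 1") auto
      have t3: "t \<ge> 3"
        using s1 s no[unfolded not_ex] by (metis One_nat_def Suc_leI assms(3) le_antisym not_less_eq_eq numeral_2_eq_2
          numeral_3_eq_3 power_0 power_one_right)
      obtain g :: "'a poly" where g: "poly g 1 \<noteq> 0" "mirimanoff t = [:0, 1:] * ([:-1, 1:] ^ (2 ^ k) * g)"
        using mirimanoff_factorization[OF char, of s k] s s1 by metis
      define f where "f = [:-1, 1:] ^ (2 ^ k) * g"
      have f0: "f \<noteq> 0" using g(1) by (auto simp: f_def)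
      have Mf: "mirimanoff t = [:0, 1:] * f" using g(2) by (simp only: f_def)
      then have M0: "(mirimanoff t :: 'a poly) \<noteq> 0" using f0 by simp
      note dM = degree_mirimanoff[OF char assms(3) M0]
      have deg: "degree f \<le> t - 2" using dM(1) f0 unfolding Mf by (simp add: degree_mult_eq)
      have lc: "lead_coeff f = 1" using dM(2) unfolding Mf lead_coeff_mult by simp
      have "degree f \<ge> 1"
        using g(1) unfolding f_def by (subst degree_mult_eq) (auto simp: degree_linear_power intro: trans_le_add1)
      define d where "d = gcd (t - 2) (?q - 1)"
      have d: "d > 0" "d \<le> t - 2" using t3 by (auto simp: d_def intro: gcd_le1_nat)
      have "d dvd ?q - 1" by (simp add: d_def)
      then obtain E where E: "d * E = ?q - 1" by (metis dvdE)
      have "odd (?q - 1)" using assms(1,2) by simp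
      then have "odd d" using \<open>d dvd ?q - 1\<close> dvd_trans by blast
      then have cop: "coprime (2 ^ k) d" by simp
      define N where "N = {x. poly f x \<noteq> 0 \<and> (a * poly f x) ^ E = 1}"
      have "real ?q - real (degree f) - (real d - 1) * ((real (degree f) - 1) * sqrt (real ?q)) \<le> real d * real (card N)"
        unfolding N_def
        using kummer_power_residue_count[of r f 1 "2 ^ k" g d E a] char assms(2,5) g(1) lc d(1) cop E
        by (simp add: f_def)
      \<comment> \<open>The comparison is with \<open>d\<close>, not 0, in order to get two elements
        of \<open>N\<close>: the point x = 0 has to be discarded.\<close>
      moreover have "real d < real ?q - real (degree f) - (real d - 1) * ((real (degree f) - 1) * sqrt (real ?q))"
      proof -
        define R where "R = sqrt (real ?q)"
        define T where "T = real t"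
        have T: "T \<ge> 3" using t3 by (simp add: T_def)
        have "(T ^ 2) ^ 2 \<le> real ?q"
          using assms(2,4) by (simp add: T_def flip: power_mult) (metis of_nat_le_iff of_nat_numeral of_nat_power)
        then have R: "T ^ 2 \<le> R" unfolding R_def by (intro real_le_rsqrt)
        have RR: "real ?q = R * R" by (simp add: R_def)
        have R0: "R \<ge> 9" using R power_mono[of 3 T 2] T by simp
        have "(real d - 1) * ((real (degree f) - 1) * R) \<le> (T - 3) * ((T - 3) * R)"
          using d deg \<open>degree f \<ge> 1\<close> t3 R0 unfolding T_def by (intro mult_mono mult_right_mono) auto
        moreover have "real d + real (degree f) \<le> 2 * T" using d(2) deg t3 by (simp add: T_def)
        \<comment> \<open>Since (T - 3)^2 = T^2 - (6 T - 9) and R >= T^2, at least R (6 T - 9)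
          remains, which with R >= 9 exceeds 2 T.\<close>
        moreover have "2 * T < R * R - (T - 3) * ((T - 3) * R)"
        proof -
          have "2 * T < 9 * (6 * T - 9)" using T by simp
          also have "\<dots> \<le> R * (6 * T - 9)" using R0 T by (intro mult_right_mono) auto
          also have "\<dots> = R * T ^ 2 - (T - 3) * ((T - 3) * R)"
            by (simp add: power2_eq_square algebra_simps)
          also have "\<dots> \<le> R * R - (T - 3) * ((T - 3) * R)"
            using R R0 by (intro diff_right_mono mult_left_mono) auto
          finally show ?thesis .
        qed
        ultimately show ?thesis unfolding R_def[symmetric] using RR by linarith
      qed
      ultimately have "real d * 1 < real d * real (card N)" by linarith
      then have "card N > 1" using d(1) by simp
      then have "\<not> N \<subseteq> {0}" using card_mono[of "{0}" N] by auto
      then obtain x where x: "x \<in> N" "x \<noteq> 0" by auto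
      have "a * poly f x \<noteq> 0" "(a * poly f x) ^ E = 1" using x(1) assms(5) by (simp_all add: N_def)
      moreover have "t - 2 > 0" using t3 by simp
      ultimately obtain w where "a * poly f x * w ^ (t - 2) = 1"
        using E unfolding d_def by (rule power_residue)
      moreover have "x * poly f x = (x + 1) ^ t + x ^ t + 1"
        using arg_cong[OF Mf, of "\<lambda>p. poly p x"] by (simp add: poly_mirimanoff)
      ultimately show False
        using planar_monomial_avoids[OF char pl _ x(2)] t3 by auto
    qed
  qed
qed

end
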